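(* Let $n\geq 1$ be an integer, let $p_1,p_2$ be real numbers, let $\beta>n$, and let $(u,v)$ be a pair of positive entire solutions of the system $$\begin{cases}u(x)=\displaystyle\int_{\mathbb{R}^n}|x-y|^{\beta-n}\,v^{-p_2}(y)\,|y|^{\beta}\,dy,\\[2mm] v(x)=\displaystyle\int_{\mathbb{R}^n}|x-y|^{\beta-n}\,u^{-p_1}(y)\,|x|^{\beta}\,dy.\end{cases}$$ Suppose that either $p_1>\frac{\beta}{\beta-n}$ or $\frac{2\beta}{2\beta-n}<p_2<\frac{n+\beta}{\beta}$. Then: (i) $u(x)\simeq|x|^{\beta-n}$ and $v(x)\simeq|x|^{2\beta-n}$ when $|x|\to\infty$; and $v(x)\simeq|x|^{\beta}$ when $|x|\to0$. (ii) $u^{-1}\in L^s(\mathbb{R}^n)$ for all $s>\frac{n}{\beta-n}$, and $v^{-1}\in L^t(\mathbb{R}^n)$ for all $t\in\left(\frac{n}{2\beta-n},\frac{n}{\beta}\right)$. (iii) If, furthermore, $u$ and $v$ are differentiable, then $$\frac{1}{p_1-1}+\frac{1}{p_2-1}=\frac{2\beta}{n}-1.$$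
   Context: For $\beta\geq0$, $(u,v)$ is called a pair of positive entire solutions of the system if $u,v\in L^\infty_{loc}(\mathbb{R}^n)$ (locally bounded on $\mathbb{R}^n$) satisfy both equations pointwise on $\mathbb{R}^n$, $u>0$ in $\mathbb{R}^n$, $v>0$ in $\mathbb{R}^n\setminus\{0\}$, and $v(0)=0$. The notation $f(x)\simeq g(x)$ when $|x|\to\infty$ (respectively $|x|\to0$) means that there is a constant $C\geq1$ such that $C^{-1}g(x)\leq f(x)\leq C g(x)$ for all $x$ with $|x|$ sufficiently large (respectively for all $x\neq0$ with $|x|$ sufficiently small). *)

theory Defs
  imports "HOL-Analysis.Analysis"
begin

definition Linfty_loc :: "('a::euclidean_space \<Rightarrow> real) \<Rightarrow> bool" where
  "Linfty_loc f \<longleftrightarrow> f \<in> borel_measurable lebesgue \<and>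
     (\<forall>K. compact K \<longrightarrow> (\<exists>C. AE x in lebesgue. x \<in> K \<longrightarrow> \<bar>f x\<bar> \<le> C))"

definition in_Lp :: "real \<Rightarrow> ('a::euclidean_space \<Rightarrow> real) \<Rightarrow> bool" where
  "in_Lp s f \<longleftrightarrow> f \<in> borel_measurable lebesgue \<and> integrable lebesgue (\<lambda>x. \<bar>f x\<bar> powr s)"

text \<open>The filters of interest are \<open>at_infinity\<close> (large norm) and \<open>at 0\<close>
  (small norm, the origin itself excluded).\<close>

definition comparable :: "('a \<Rightarrow> real) \<Rightarrow> ('a \<Rightarrow> real) \<Rightarrow> 'a filter \<Rightarrow> bool" where
  "comparable f g F \<longleftrightarrow>
     (\<exists>C\<ge>1. eventually (\<lambda>x. inverse C * g x \<le> f x \<and> f x \<le> C * g x) F)"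

text \<open>\<open>has_bochner_integral\<close> makes each equation assert that the integral converges
  and equals the left-hand side, at every point \<open>x\<close>. The value \<open>0 powr (- p2) = 0\<close>
  occurs only at the null set \<open>y = 0\<close>, where \<open>v\<close> vanishes.\<close>

definition positive_entire_solutions ::
  "real \<Rightarrow> real \<Rightarrow> real \<Rightarrow> (real ^ 'n \<Rightarrow> real) \<Rightarrow> (real ^ 'n \<Rightarrow> real) \<Rightarrow> bool" where
  "positive_entire_solutions \<beta> p1 p2 u v \<longleftrightarrow>
     Linfty_loc u \<and> Linfty_loc v \<and>
     (\<forall>x. u x > 0) \<and> (\<forall>x. x \<noteq> 0 \<longrightarrow> v x > 0) \<and> v 0 = 0 \<and>
     (\<forall>x. has_bochner_integral lebesgue
        (\<lambda>y. norm (x - y) powr (\<beta> - real CARD('n)) * v y powr (- p2) * norm y powr \<beta>) (u x)) \<and>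
     (\<forall>x. has_bochner_integral lebesgue
        (\<lambda>y. norm (x - y) powr (\<beta> - real CARD('n)) * u y powr (- p1) * norm x powr \<beta>) (v x))"

end

theory Submission
  imports Defs
begin

text \<open>
  Write \<open>a = \<beta> - n\<close>, \<open>f = v powr - p2 * |y| powr \<beta>\<close>, \<open>g = u powr - p1\<close> and
  \<open>v = |x| powr \<beta> * w\<close>, so that \<open>u\<close> and \<open>w\<close> are the potentials of \<open>f\<close> and \<open>g\<close> with kernel
  \<open>|x - y| powr a\<close>. Finiteness of a potential at two points forces
  \<open>(1 + |y|) powr a\<close> to be integrable against the density, and then the potential is comparable to
  \<open>(1 + |x|) powr a\<close> on the whole space. This gives (i) and (ii).

  For (iii), the Pohozaev identity is obtained without differentiating \<open>u\<close> and \<open>v\<close>. Let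
  \<open>J l\<close> be the double integral of \<open>|l x - y| powr a * f y * g x\<close> and \<open>A = J 1\<close>. Then
  \<open>J l\<close> is the integral of \<open>u (l x) * u x powr - p1\<close> and also \<open>l powr (\<beta> + a)\<close> times that of
  \<open>v (x / l) * v x powr - p2\<close>. Convexity of \<open>t powr (1 - p)\<close> bounds both expressions from below by
  explicit functions of \<open>l\<close> that are equal to \<open>A\<close> at \<open>l = 1\<close>. Since \<open>J\<close> is differentiable at \<open>1\<close>, both
  functions have the same slope there, which is the claimed relation. For \<open>a < 1\<close> the derivative of
  the kernel is singular on the diagonal, and the decay of \<open>g\<close> that follows from its weighted
  integrability makes it integrable.
\<close>

section \<open>Elementary inequalities for real powers\<close>

text \<open>For these exponents \<open>r powr b\<close> is convex in \<open>r\<close>, so it lies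
  above its tangent at \<open>1\<close>. When \<open>b \<le> 0\<close> the bounds
  \<open>ln r \<le> r - 1\<close> and \<open>1 + z \<le> exp z\<close> already give this.\<close>

lemma powr_ge_tangent_line:
  fixes r b :: real
  assumes "r > 0" and b: "b \<le> 0 \<or> 1 \<le> b"
  shows "1 + b * (r - 1) \<le> r powr b"
  using b
proof
  assume "b \<le> 0"
  have "b * (r - 1) \<le> b * ln r"
    using ln_le_minus_one[OF \<open>r > 0\<close>] \<open>b \<le> 0\<close> by (intro mult_left_mono_neg) auto
  also have "1 + b * ln r \<le> exp (b * ln r)" by (rule exp_ge_add_one_self)
  finally show ?thesis using \<open>r > 0\<close> by (simp add: powr_def)
next
  assume "1 \<le> b"
  have "r powr b - 1 powr b \<ge> b * (r - 1)"
    using assms powr_convex[OF \<open>1 \<le> b\<close>]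
    by (intro convex_on_imp_above_tangent[where A = "{0<..}"])
      (auto simp: interior_open intro!: derivative_eq_intros)
  then show ?thesis by simp
qed

text \<open>Scaling by \<open>s\<close> reduces the claim to a comparison with \<open>1\<close>, and
  there \<open>r powr a\<close> lies between \<open>1\<close> and \<open>r\<close>. The slope on the
  right depends on \<open>s\<close> alone, so a varying \<open>t\<close> may come arbitrarily close
  to \<open>0\<close>.\<close>

lemma abs_powr_diff_le_concave:
  fixes s t a :: real
  assumes "0 < s" "0 \<le> t" "0 < a" "a \<le> 1"
  shows "\<bar>t powr a - s powr a\<bar> \<le> s powr (a - 1) * \<bar>t - s\<bar>"
proof -
  define r where "r = t / s"
  have t: "t = r * s" and r: "0 \<le> r" using assms by (auto simp: r_def)
  have "\<bar>r powr a - 1\<bar> \<le> \<bar>r - 1\<bar>"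
  proof (cases "1 \<le> r")
    case True
    then have "r powr a \<le> r powr 1" "1 \<le> r powr a"
      using assms powr_mono[of a 1 r] by (auto simp: ge_one_powr_ge_zero)
    then show ?thesis using True by simp
  next
    case False
    then have "r powr 1 \<le> r powr a" "r powr a \<le> 1"
      using assms r powr_mono'[of a 1 r] by (auto simp: powr_le1)
    then show ?thesis using False r by simp
  qed
  then have "s powr a * \<bar>r powr a - 1\<bar> \<le> s powr a * \<bar>r - 1\<bar>"
    by (intro mult_left_mono) auto
  also have "s powr a * \<bar>r powr a - 1\<bar> = \<bar>t powr a - s powr a\<bar>"
  proof -
    have "t powr a - s powr a = s powr a * (r powr a - 1)"
      using assms r by (simp add: t powr_mult algebra_simps)
    then show ?thesis by (simp add: abs_mult)
  qed
  also have "s powr a * \<bar>r - 1\<bar> = s powr (a - 1) * \<bar>t - s\<bar>"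
  proof -
    have "\<bar>t - s\<bar> = s * \<bar>r - 1\<bar>"
    proof -
      have "t - s = s * (r - 1)" by (simp add: t algebra_simps)
      then show ?thesis using assms by (simp add: abs_mult)
    qed
    moreover have "s powr a = s powr (a - 1) * s"
      using assms by (simp add: powr_diff)
    ultimately show ?thesis by simp
  qed
  finally show ?thesis .
qed

lemma abs_powr_diff_le_convex:
  fixes s t a :: real
  assumes "0 \<le> s" "0 \<le> t" "1 \<le> a"
  shows "\<bar>t powr a - s powr a\<bar> \<le> a * max s t powr (a - 1) * \<bar>t - s\<bar>"
proof -
  \<comment> \<open>The tangent is taken at the larger argument \<open>t\<close> and evaluated at
    \<open>s\<close>. The case \<open>s = 0\<close> is separate because the tangent bound needs a
    positive ratio \<open>s / t\<close>.\<close>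
  have *: "t powr a - s powr a \<le> a * t powr (a - 1) * (t - s)" if "0 \<le> s" "s < t" for s t :: real
  proof (cases "s = 0")
    case True
    have "t powr a = t powr (a - 1) * t" using that by (simp add: powr_diff)
    moreover have "t powr (a - 1) * t \<le> a * (t powr (a - 1) * t)"
      using that assms mult_right_mono[of 1 a "t powr (a - 1) * t"] by simp
    ultimately show ?thesis using True by simp
  next
    case False
    with that have "1 + a * (s / t - 1) \<le> (s / t) powr a"
      using assms by (intro powr_ge_tangent_line) auto
    then have "t powr a * (1 + a * (s / t - 1)) \<le> t powr a * (s / t) powr a"
      by (intro mult_left_mono) auto
    also have "\<dots> = s powr a" using that by (simp add: powr_divide)
    also have "t powr a * (1 + a * (s / t - 1)) = t powr a - a * t powr (a - 1) * (t - s)"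
      using that by (simp add: powr_diff field_simps)
    finally show ?thesis by simp
  qed
  consider "s < t" | "t < s" | "s = t" by linarith
  then show ?thesis
  proof cases
    case 1
    moreover have "s powr a \<le> t powr a" using 1 assms by (intro powr_mono2) auto
    ultimately show ?thesis using *[of s t] assms by (simp add: max_def)
  next
    case 2
    moreover have "t powr a \<le> s powr a" using 2 assms by (intro powr_mono2) auto
    ultimately show ?thesis using *[of t s] assms by (simp add: max_def)
  qed simp
qed

section \<open>Sigma-finiteness and scaling of Lebesgue measure\<close>

text \<open>Completion does not change the measure of Borel sets, so a cover that works for
  \<open>lborel\<close> works here. This makes Fubini available for Lebesgue measurable
  densities.\<close>

lemma sigma_finite_lebesgue: "sigma_finite_measure (lebesgue :: 'a::euclidean_space measure)"
proof
  obtain A :: "'a set set" where A: "countable A" "A \<subseteq> sets lborel" "\<Union>A = space lborel"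
      "\<forall>a\<in>A. emeasure lborel a \<noteq> \<infinity>"
    using lborel.sigma_finite_countable by blast
  then show "\<exists>A. countable A \<and> A \<subseteq> sets lebesgue \<and> \<Union>A = space (lebesgue :: 'a measure) \<and>
      (\<forall>a\<in>A. emeasure lebesgue a \<noteq> \<infinity>)"
    by (intro exI[of _ A]) (auto simp: subset_iff)
qed

text \<open>The dilation is an affine map with the same coefficient \<open>c\<close> in every
  coordinate, so \<open>lebesgue\<close> is its own image under the dilation with density
  \<open>c ^ DIM('a)\<close>.\<close>

lemma integral_lebesgue_scaleR:
  fixes U :: "'a::euclidean_space \<Rightarrow> real"
  assumes "c > 0" "U \<in> borel_measurable lebesgue"
  shows "integrable lebesgue U \<Longrightarrow> integrable lebesgue (\<lambda>x. U (c *\<^sub>R x))"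
    and "(\<integral>x. U (c *\<^sub>R x) \<partial>lebesgue) = c powr - real DIM('a) * (\<integral>x. U x \<partial>lebesgue)"
proof -
  let ?T = "\<lambda>x::'a. c *\<^sub>R x"
  have m: "?T \<in> lebesgue \<rightarrow>\<^sub>M lebesgue"
    using lebesgue_affine_measurable[of "\<lambda>_. c" 0] assms(1)
    by (simp add: euclidean_representation scaleR_scaleR[symmetric] scaleR_sum_right[symmetric] del: scaleR_scaleR)
  have leb: "lebesgue = density (distr lebesgue lebesgue ?T) (\<lambda>_. ennreal (c ^ DIM('a)))"
    using lebesgue_affine_euclidean[of "\<lambda>_. c" "0::'a"] assms(1)
    by (simp add: euclidean_representation scaleR_scaleR[symmetric] scaleR_sum_right[symmetric] del: scaleR_scaleR)
  have mU: "U \<in> borel_measurable (distr lebesgue lebesgue ?T)" using assms(2) by simp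
  have "(\<integral>x. U x \<partial>lebesgue) = (\<integral>x. U x \<partial>density (distr lebesgue lebesgue ?T) (\<lambda>_. ennreal (c ^ DIM('a))))"
    using leb by simp
  also have "\<dots> = c ^ DIM('a) * (\<integral>x. U (c *\<^sub>R x) \<partial>lebesgue)"
    using assms mU m by (subst integral_density) (auto simp: integral_distr)
  finally show "(\<integral>x. U (c *\<^sub>R x) \<partial>lebesgue) = c powr - real DIM('a) * (\<integral>x. U x \<partial>lebesgue)"
    using assms(1) by (simp add: powr_minus powr_realpow field_simps)
  show "integrable lebesgue (\<lambda>x. U (c *\<^sub>R x))" if "integrable lebesgue U"
  proof -
    have "integrable (density (distr lebesgue lebesgue ?T) (\<lambda>_. ennreal (c ^ DIM('a)))) U"
      using that leb by simp
    then have "integrable (distr lebesgue lebesgue ?T) (\<lambda>x. c ^ DIM('a) * U x)"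
      using assms mU by (subst (asm) integrable_density) auto
    then show ?thesis
      using assms m by (auto simp: integrable_distr_eq)
  qed
qed

subsection \<open>Potentials of positive densities\<close>

lemma measurable_ident_lebesgue_borel [measurable]: "(\<lambda>x. x) \<in> borel_measurable lebesgue"
  by (rule measurable_completion) simp

lemma AE_lebesgue_neq: "AE x in lebesgue. x \<noteq> (c :: 'a::euclidean_space)"
  by (rule AE_I'[of "{c}"]) auto

text \<open>A zero integral would make \<open>f\<close> vanish almost everywhere on the ball, hence
  make the ball a null set. Positivity is asked only off the origin because the density built from
  \<open>v\<close> vanishes there.\<close>

lemma integral_ball_pos:
  fixes f :: "'a::euclidean_space \<Rightarrow> real"
  assumes f: "integrable lebesgue f" and nonneg: "\<And>y. 0 \<le> f y" and pos: "\<And>y. y \<noteq> 0 \<Longrightarrow> 0 < f y"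
  shows "0 < (\<integral>y. indicator (ball c 1) y * f y \<partial>lebesgue)"
proof (rule ccontr)
  assume "\<not> ?thesis"
  moreover have int: "integrable lebesgue (\<lambda>y. indicator (ball c 1) y * f y)"
    using integrable_mult_indicator[OF _ f, of "ball c 1"] by simp
  moreover have "0 \<le> (\<integral>y. indicator (ball c 1) y * f y \<partial>lebesgue)"
    by (intro Bochner_Integration.integral_nonneg) (auto simp: nonneg)
  ultimately have "AE y in lebesgue. indicator (ball c 1) y * f y = 0"
    by (subst integral_nonneg_eq_0_iff_AE[symmetric]) (auto simp: nonneg)
  with AE_lebesgue_neq[of 0] have "AE y in lebesgue. y \<notin> ball c 1"
    by eventually_elim (use pos in \<open>fastforce simp: indicator_def split: if_splits\<close>)
  then have "emeasure lebesgue (ball c 1) = 0"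
    by (subst (asm) AE_iff_measurable[of "ball c 1"]) auto
  moreover have "0 < emeasure lebesgue (ball c 1)"
    by (simp add: emeasure_ball unit_ball_vol_pos)
  ultimately show False by simp
qed

text \<open>The larger of the distances from \<open>y\<close> to a unit vector and to its negative
  is at least \<open>(1 + norm y) / 2\<close>, so two kernels together dominate the weight.\<close>

lemma potential_weight_integrable:
  fixes f :: "'a::euclidean_space \<Rightarrow> real"
  assumes a: "0 < a" and [measurable]: "f \<in> borel_measurable lebesgue" and nonneg: "\<And>y. 0 \<le> f y"
    and int: "\<And>x. x \<noteq> 0 \<Longrightarrow> integrable lebesgue (\<lambda>y. norm (x - y) powr a * f y)"
  shows "integrable lebesgue (\<lambda>y. (1 + norm y) powr a * f y)"
proof -
  \<comment> \<open>Two antipodal points are used because the equation for \<open>v\<close> says nothing about the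
    potential at the origin, where it is multiplied by \<open>norm 0 powr \<beta> = 0\<close>.\<close>
  obtain e :: 'a where e: "e \<in> Basis" using nonempty_Basis by blast
  then have "e \<noteq> 0" by auto
  then have "integrable lebesgue (\<lambda>y. 2 powr a * (norm (e - y) powr a * f y + norm (- e - y) powr a * f y))"
    by (intro integrable_mult_right Bochner_Integration.integrable_add int) auto
  then show ?thesis
  proof (rule Bochner_Integration.integrable_bound)
    show "AE y in lebesgue. norm ((1 + norm y) powr a * f y)
      \<le> norm (2 powr a * (norm (e - y) powr a * f y + norm (- e - y) powr a * f y))"
    proof (rule AE_I2)
      fix y :: 'a
      have "norm ((e - y) - (- e - y)) \<le> norm (e - y) + norm (- e - y)"
        by (rule norm_triangle_ineq4)
      moreover have "(e - y) - (- e - y) = 2 *\<^sub>R e" by (simp add: scaleR_2)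
      moreover have "norm ((e - y) + (- e - y)) \<le> norm (e - y) + norm (- e - y)"
        by (rule norm_triangle_ineq)
      moreover have "(e - y) + (- e - y) = - (2 *\<^sub>R y)" by (simp add: scaleR_2)
      ultimately have "2 \<le> norm (e - y) + norm (- e - y)" "2 * norm y \<le> norm (e - y) + norm (- e - y)"
        using e by simp_all
      then have "1 + norm y \<le> 2 * max (norm (e - y)) (norm (- e - y))" by linarith
      then have "(1 + norm y) powr a \<le> (2 * max (norm (e - y)) (norm (- e - y))) powr a"
        using a by (intro powr_mono2) auto
      also have "\<dots> = 2 powr a * max (norm (e - y)) (norm (- e - y)) powr a"
        by (simp add: powr_mult)
      also have "\<dots> \<le> 2 powr a * (norm (e - y) powr a + norm (- e - y) powr a)"
        by (intro mult_left_mono) (auto simp: max_def)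
      finally have "(1 + norm y) powr a * f y \<le> 2 powr a * (norm (e - y) powr a + norm (- e - y) powr a) * f y"
        using nonneg by (intro mult_right_mono)
      then show "norm ((1 + norm y) powr a * f y)
        \<le> norm (2 powr a * (norm (e - y) powr a * f y + norm (- e - y) powr a * f y))"
        using nonneg[of y] by (simp add: algebra_simps)
    qed
  qed measurable
qed

lemma norm_diff_le_mult: "norm (x - y) \<le> (1 + norm x) * (1 + norm y)"
proof -
  have "norm (x - y) \<le> norm x + norm y" by (rule norm_triangle_ineq4)
  also have "\<dots> \<le> (1 + norm x) * (1 + norm y)" by (simp add: algebra_simps)
  finally show ?thesis .
qed

lemma potential_kernel_le:
  assumes "0 < a" "0 \<le> t"
  shows "norm (x - y) powr a * t \<le> (1 + norm x) powr a * ((1 + norm y) powr a * t)"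
proof -
  have "norm (x - y) powr a \<le> ((1 + norm x) * (1 + norm y)) powr a"
    using assms norm_diff_le_mult by (intro powr_mono2) auto
  then show ?thesis
    using assms by (simp add: powr_mult mult_right_mono flip: mult.assoc)
qed

lemma potential_integrable:
  fixes f :: "'a::euclidean_space \<Rightarrow> real"
  assumes a: "0 < a" and [measurable]: "f \<in> borel_measurable lebesgue" and nonneg: "\<And>y. 0 \<le> f y"
    and w: "integrable lebesgue (\<lambda>y. (1 + norm y) powr a * f y)"
  shows "integrable lebesgue (\<lambda>y. norm (x - y) powr a * f y)"
proof (rule Bochner_Integration.integrable_bound[OF integrable_mult_right[OF w, of "(1 + norm x) powr a"]])
  show "AE y in lebesgue. norm (norm (x - y) powr a * f y) \<le>
      norm ((1 + norm x) powr a * ((1 + norm y) powr a * f y))"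
    using potential_kernel_le[OF a nonneg] nonneg by (intro AE_I2) (simp add: abs_mult)
qed measurable

lemma integrable_of_weight:
  fixes f :: "'a::euclidean_space \<Rightarrow> real"
  assumes a: "0 < a" and [measurable]: "f \<in> borel_measurable lebesgue"
    and int: "integrable lebesgue (\<lambda>y. (1 + norm y) powr a * f y)"
  shows "integrable lebesgue f"
  using int
proof (rule Bochner_Integration.integrable_bound)
  show "AE y in lebesgue. norm (f y) \<le> norm ((1 + norm y) powr a * f y)"
  proof (rule AE_I2)
    fix y :: 'a
    have "1 \<le> (1 + norm y) powr a" using a by (intro ge_one_powr_ge_zero) auto
    then have "1 * \<bar>f y\<bar> \<le> (1 + norm y) powr a * \<bar>f y\<bar>" by (intro mult_right_mono) auto
    then show "norm (f y) \<le> norm ((1 + norm y) powr a * f y)" by (simp add: abs_mult)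
  qed
qed simp

text \<open>Only the mass in one unit ball is kept. On that ball the kernel is at least
  \<open>((1 + norm x) / 4) powr a\<close>, which is the source of the factor
  \<open>4 powr - a\<close>.\<close>

lemma potential_lower_bound:
  fixes f :: "'a::euclidean_space \<Rightarrow> real" and c x :: 'a
  assumes a: "0 < a" and [measurable]: "f \<in> borel_measurable lebesgue" and nonneg: "\<And>y. 0 \<le> f y"
    and int: "\<And>x. integrable lebesgue (\<lambda>y. norm (x - y) powr a * f y)"
    and f: "integrable lebesgue f"
    and S: "\<And>y. y \<in> ball c 1 \<Longrightarrow> (1 + norm x) / 4 \<le> norm (x - y)"
  shows "(1 + norm x) powr a * (4 powr - a * (\<integral>y. indicator (ball c 1) y * f y \<partial>lebesgue))
    \<le> (\<integral>y. norm (x - y) powr a * f y \<partial>lebesgue)"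
proof -
  have "(1 + norm x) powr a * (4 powr - a * (\<integral>y. indicator (ball c 1) y * f y \<partial>lebesgue)) =
      (\<integral>y. ((1 + norm x) / 4) powr a * (indicator (ball c 1) y * f y) \<partial>lebesgue)"
    by (subst Bochner_Integration.integral_mult_right_zero) (simp add: powr_divide powr_minus field_simps)
  also have "\<dots> \<le> (\<integral>y. norm (x - y) powr a * f y \<partial>lebesgue)"
  proof (rule integral_mono)
    show "integrable lebesgue (\<lambda>y. ((1 + norm x) / 4) powr a * (indicator (ball c 1) y * f y))"
      using integrable_mult_indicator[OF _ f, of "ball c 1"] by simp
    show "((1 + norm x) / 4) powr a * (indicator (ball c 1) y * f y) \<le> norm (x - y) powr a * f y" for y
    proof (cases "y \<in> ball c 1")
      case True
      then have "((1 + norm x) / 4) powr a \<le> norm (x - y) powr a"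
        using a S by (intro powr_mono2) auto
      then show ?thesis using True nonneg by (auto intro: mult_right_mono)
    qed (simp add: nonneg)
  qed (rule int)
  finally show ?thesis .
qed

text \<open>From above, the kernel splits into a weight in \<open>x\<close> and a weight in
  \<open>y\<close>, and \<open>M\<close> is the weighted mass of \<open>f\<close>. From below, the
  mass in a ball far from \<open>x\<close> is enough.\<close>

lemma potential_comparable:
  fixes f :: "'a::euclidean_space \<Rightarrow> real"
  assumes a: "0 < a" and [measurable]: "f \<in> borel_measurable lebesgue" and nonneg: "\<And>y. 0 \<le> f y"
    and pos: "\<And>y. y \<noteq> 0 \<Longrightarrow> 0 < f y"
    and int: "\<And>x. integrable lebesgue (\<lambda>y. norm (x - y) powr a * f y)"
  obtains m M where "0 < m" "0 < M"
    "\<And>x. m * (1 + norm x) powr a \<le> (\<integral>y. norm (x - y) powr a * f y \<partial>lebesgue)"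
    "\<And>x. (\<integral>y. norm (x - y) powr a * f y \<partial>lebesgue) \<le> M * (1 + norm x) powr a"
proof -
  note w = potential_weight_integrable[OF a assms(2) nonneg int]
  note f = integrable_of_weight[OF a assms(2) w]
  define M where "M = (\<integral>y. (1 + norm y) powr a * f y \<partial>lebesgue)"
  obtain e :: 'a where e: "e \<in> Basis" using nonempty_Basis by blast
  \<comment> \<open>Every \<open>x\<close> is far from one of the unit balls around \<open>0\<close> and \<open>5 *\<^sub>R e\<close>,
    relative to \<open>1 + norm x\<close>.\<close>
  define I where "I c = 4 powr - a * (\<integral>y. indicator (ball c 1) y * f y \<partial>lebesgue)" for c :: 'a
  have I: "0 < I c" for c using integral_ball_pos[OF f nonneg pos] by (simp add: I_def)
  define m where "m = min (I 0) (I (5 *\<^sub>R e))"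
  have "m > 0" using I by (simp add: m_def)
  \<comment> \<open>The ball around \<open>0\<close> serves once \<open>norm x \<ge> 5/3\<close>,
    the ball around \<open>5 *\<^sub>R e\<close> as long as \<open>norm x \<le> 3\<close>; the
    threshold \<open>2\<close> lies between.\<close>
  have lower: "m * (1 + norm x) powr a \<le> (\<integral>y. norm (x - y) powr a * f y \<partial>lebesgue)" for x
  proof (cases "norm x \<ge> 2")
    case True
    have "(1 + norm x) / 4 \<le> norm (x - y)" if "y \<in> ball 0 1" for y
      using True that norm_triangle_ineq2[of x y] by simp
    from potential_lower_bound[OF a assms(2) nonneg int f this]
    have "(1 + norm x) powr a * I 0 \<le> (\<integral>y. norm (x - y) powr a * f y \<partial>lebesgue)"
      unfolding I_def by blast
    moreover have "m * (1 + norm x) powr a \<le> I 0 * (1 + norm x) powr a"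
      by (intro mult_right_mono) (auto simp: m_def)
    ultimately show ?thesis by (simp add: mult.commute)
  next
    case False
    have "(1 + norm x) / 4 \<le> norm (x - y)" if "y \<in> ball (5 *\<^sub>R e) 1" for y
    proof -
      have "norm (5 *\<^sub>R e) \<le> norm (5 *\<^sub>R e - y) + norm (x - y) + norm x" by norm
      then show ?thesis using False that e by (simp add: dist_norm)
    qed
    from potential_lower_bound[OF a assms(2) nonneg int f this]
    have "(1 + norm x) powr a * I (5 *\<^sub>R e) \<le> (\<integral>y. norm (x - y) powr a * f y \<partial>lebesgue)"
      unfolding I_def by blast
    moreover have "m * (1 + norm x) powr a \<le> I (5 *\<^sub>R e) * (1 + norm x) powr a"
      by (intro mult_right_mono) (auto simp: m_def)
    ultimately show ?thesis by (simp add: mult.commute)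
  qed
  have upper: "(\<integral>y. norm (x - y) powr a * f y \<partial>lebesgue) \<le> M * (1 + norm x) powr a" for x
  proof -
    have "(\<integral>y. norm (x - y) powr a * f y \<partial>lebesgue) \<le>
        (\<integral>y. (1 + norm x) powr a * ((1 + norm y) powr a * f y) \<partial>lebesgue)"
    proof (rule integral_mono)
      show "norm (x - y) powr a * f y \<le> (1 + norm x) powr a * ((1 + norm y) powr a * f y)" for y
        by (rule potential_kernel_le[OF a nonneg])
    qed (use int w in auto)
    then show ?thesis by (simp add: M_def mult.commute)
  qed
  have "0 < m * (1 + norm (0::'a)) powr a" using \<open>m > 0\<close> by simp
  also have "\<dots> \<le> M * (1 + norm (0::'a)) powr a" using lower[of 0] upper[of 0] by linarith
  finally have "M > 0" by simp
  show ?thesis using that \<open>m > 0\<close> \<open>M > 0\<close> lower upper by blast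
qed

subsection \<open>Integrals of powers of the norm\<close>

text \<open>Termwise integration leaves a geometric series of weighted ball volumes. Shrinking radii
  handle a point singularity, growing radii the decay at infinity.\<close>

lemma nn_integral_le_geometric_balls:
  fixes F :: "'a::euclidean_space \<Rightarrow> ennreal"
  assumes le: "\<And>x. F x \<le> (\<Sum>k. ennreal (h k) * indicator (ball c (r k)) x)"
    and r: "\<And>k. 0 \<le> r k" and h: "\<And>k. 0 \<le> h k"
    and eq: "\<And>k. h k * r k ^ DIM('a) = A * q ^ k" and q: "0 \<le> q" "q < 1" and A: "0 \<le> A"
  shows "(\<integral>\<^sup>+x. F x \<partial>lebesgue) \<le> ennreal (unit_ball_vol (real DIM('a)) * A / (1 - q))"
proof -
  have "(\<integral>\<^sup>+x. F x \<partial>lebesgue) \<le> (\<integral>\<^sup>+x. (\<Sum>k. ennreal (h k) * indicator (ball c (r k)) x) \<partial>lebesgue)"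
    by (intro nn_integral_mono le)
  also have "\<dots> = (\<Sum>k. \<integral>\<^sup>+x. ennreal (h k) * indicator (ball c (r k)) x \<partial>lebesgue)"
    by (intro nn_integral_suminf borel_measurable_times_ennreal borel_measurable_indicator) auto
  also have "\<dots> = (\<Sum>k. ennreal (unit_ball_vol (real DIM('a)) * A * q ^ k))"
  proof (intro suminf_cong)
    fix k
    have "(\<integral>\<^sup>+x. ennreal (h k) * indicator (ball c (r k)) x \<partial>lebesgue) =
        ennreal (h k) * ennreal (unit_ball_vol (real DIM('a)) * r k ^ DIM('a))"
      by (subst nn_integral_cmult_indicator) (use r in \<open>simp_all add: emeasure_ball\<close>)
    also have "\<dots> = ennreal (unit_ball_vol (real DIM('a)) * (h k * r k ^ DIM('a)))"
      using h[of k] r[of k] by (simp add: ennreal_mult[symmetric] mult_ac)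
    finally show "(\<integral>\<^sup>+x. ennreal (h k) * indicator (ball c (r k)) x \<partial>lebesgue) =
        ennreal (unit_ball_vol (real DIM('a)) * A * q ^ k)"
      by (simp add: eq mult.assoc)
  qed
  also have "\<dots> = ennreal (unit_ball_vol (real DIM('a)) * A * (1 / (1 - q)))"
    using q A by (intro sums_unique[symmetric] sums_ennreal[THEN iffD2] sums_mult geometric_sums)
      auto
  finally show ?thesis by simp
qed

lemma indicator_le_suminf:
  fixes h :: "nat \<Rightarrow> real"
  assumes "t \<le> h k" "x \<in> B k"
  shows "ennreal t \<le> (\<Sum>k. ennreal (h k) * indicator (B k) x)"
proof -
  have "ennreal t \<le> sum (\<lambda>k. ennreal (h k) * indicator (B k) x) {k}"
    using assms by (simp add: ennreal_leI)
  also have "\<dots> \<le> (\<Sum>k. ennreal (h k) * indicator (B k) x)"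
    by (rule sum_le_suminf) auto
  finally show ?thesis .
qed

text \<open>The ball is cut into dyadic shells around \<open>y\<close>, on each of which the power
  is at most its value at the inner radius. The constant \<open>K\<close> is uniform in
  \<open>y\<close> and \<open>R\<close>.\<close>

lemma nn_integral_norm_powr_ball:
  fixes \<gamma> :: real
  assumes "\<gamma> \<le> 0" "- real DIM('a::euclidean_space) < \<gamma>"
  obtains K where "0 \<le> K"
    "\<And>(y::'a) R. 0 \<le> R \<Longrightarrow>
      (\<integral>\<^sup>+x. ennreal (indicator (ball y R) x * norm (x - y) powr \<gamma>) \<partial>lebesgue)
        \<le> ennreal (K * R powr (\<gamma> + real DIM('a)))"
proof -
  define d where "d = real DIM('a)"
  \<comment> \<open>\<open>q\<close> is the ratio of consecutive shell contributions, below
    \<open>1\<close> because \<open>\<gamma>\<close> exceeds minus the dimension. \<open>A\<close>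
    pays for using the inner radius of the shell together with the volume of the outer ball.\<close>
  define q where "q = (1/2::real) powr (\<gamma> + d)"
  define A where "A = (1/2::real) powr \<gamma>"
  have "q < (1/2::real) powr 0"
    unfolding q_def using assms by (intro powr_less_mono') (auto simp: d_def)
  then have q: "0 \<le> q" "q < 1" by (simp_all add: q_def)
  define K where "K = unit_ball_vol d * A / (1 - q)"
  have "0 \<le> K" using q by (simp add: K_def A_def d_def)
  moreover have "(\<integral>\<^sup>+x. ennreal (indicator (ball y R) x * norm (x - y) powr \<gamma>) \<partial>lebesgue)
        \<le> ennreal (K * R powr (\<gamma> + d))" if "0 \<le> R" for y :: 'a and R
  proof (cases "R = 0")
    case False
    with that have R: "0 < R" by simp
    have "(\<integral>\<^sup>+x. ennreal (indicator (ball y R) x * norm (x - y) powr \<gamma>) \<partial>lebesgue)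
        \<le> ennreal (unit_ball_vol (real DIM('a)) * (A * R powr (\<gamma> + d)) / (1 - q))"
    proof (rule nn_integral_le_geometric_balls)
      fix x :: 'a
      show "ennreal (indicator (ball y R) x * norm (x - y) powr \<gamma>) \<le>
        (\<Sum>k. ennreal ((R * (1/2) ^ Suc k) powr \<gamma>) * indicator (ball y (R * (1/2) ^ k)) x)"
      \<comment> \<open>The centre lies in no shell, but there the left side is
        \<open>0 powr \<gamma> = 0\<close>.\<close>
      proof (cases "x \<in> ball y R \<and> x \<noteq> y")
        case True
        then have x: "0 < norm (x - y)" "norm (x - y) < R" by (auto simp: dist_norm norm_minus_commute)
        define P where "P k \<longleftrightarrow> R * (1/2) ^ Suc k \<le> norm (x - y)" for k
        obtain k where "(1/2::real) ^ k < norm (x - y) / R"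
          using real_arch_pow_inv[of "norm (x - y) / R" "1/2"] x R by auto
        then have "R * (1/2) ^ k < norm (x - y)" using R by (simp add: field_simps)
        moreover have "R * (1/2) ^ Suc k \<le> R * (1/2) ^ k" using R by simp
        ultimately have "P k" unfolding P_def by linarith
        \<comment> \<open>Minimality of \<open>j\<close> puts \<open>x\<close> between the radii of
          index \<open>j + 1\<close> and \<open>j\<close>; for \<open>j = 0\<close> the outer bound
          is membership in the ball.\<close>
        define j where "j = (LEAST k. P k)"
        have "P j" unfolding j_def by (rule LeastI, fact)
        moreover have "norm (x - y) < R * (1/2) ^ j"
        proof (cases j)
          case (Suc i)
          then have "\<not> P i" unfolding j_def using not_less_Least[of i P] by auto
          then show ?thesis by (simp add: P_def Suc)
        qed (use x in simp)
        moreover have "norm (x - y) powr \<gamma> \<le> (R * (1/2) ^ Suc j) powr \<gamma>"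
          using \<open>P j\<close> assms R unfolding P_def by (intro powr_mono2') auto
        ultimately show ?thesis
          using True by (intro indicator_le_suminf[where k = j]) (auto simp: dist_norm norm_minus_commute)
      qed (auto simp: indicator_def)
    next
      fix k
      have "(R * (1/2) ^ Suc k) powr \<gamma> * (R * (1/2) ^ k) ^ DIM('a) =
          (R powr \<gamma> * ((1/2) * (1/2) ^ k) powr \<gamma>) * (R powr d * ((1/2) ^ k) powr d)"
        using R by (subst powr_mult[symmetric]) (simp_all add: d_def powr_realpow power_mult_distrib)
      also have "\<dots> = A * R powr (\<gamma> + d) * ((1/2) ^ k) powr (\<gamma> + d)"
        using R by (simp add: A_def powr_mult powr_add powr_divide)
      also have "((1/2) ^ k) powr (\<gamma> + d) = q ^ k"
        by (simp add: q_def powr_powr powr_realpow[symmetric] mult.commute)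
      finally show "(R * (1/2) ^ Suc k) powr \<gamma> * (R * (1/2) ^ k) ^ DIM('a) = A * R powr (\<gamma> + d) * q ^ k" .
    qed (use R q in \<open>auto simp: A_def\<close>)
    then show ?thesis by (simp add: K_def d_def mult_ac)
  qed simp
  ultimately show ?thesis using that unfolding d_def by blast
qed

lemma integrable_norm_powr_ball:
  fixes \<gamma> :: real
  assumes "\<gamma> \<le> 0" "- real DIM('a::euclidean_space) < \<gamma>"
  shows "integrable lebesgue (\<lambda>x::'a. indicator (ball 0 1) x * norm x powr \<gamma>)"
proof (rule integrableI_nonneg)
  obtain K where "0 \<le> K" "\<And>(y::'a) R. 0 \<le> R \<Longrightarrow>
      (\<integral>\<^sup>+x. ennreal (indicator (ball y R) x * norm (x - y) powr \<gamma>) \<partial>lebesgue)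
        \<le> ennreal (K * R powr (\<gamma> + real DIM('a)))"
    using nn_integral_norm_powr_ball[OF assms] by blast
  from this(2)[of 1 0]
  show "(\<integral>\<^sup>+x. ennreal (indicator (ball (0::'a) 1) x * norm x powr \<gamma>) \<partial>lebesgue) < \<infinity>"
    by (auto intro: le_less_trans)
qed (auto intro!: borel_measurable_times borel_measurable_indicator)

text \<open>The shells are \<open>2 ^ k \<le> 1 + norm x < 2 ^ (k + 1)\<close>, each inside the ball
  of radius \<open>2 ^ (k + 1)\<close>. Their contributions have ratio
  \<open>2 powr (d - q)\<close>, with \<open>d\<close> the dimension.\<close>

lemma integrable_one_plus_norm_powr:
  fixes q :: real
  assumes "real DIM('a::euclidean_space) < q"
  shows "integrable lebesgue (\<lambda>x::'a. (1 + norm x) powr - q)"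
proof (rule integrableI_nonneg)
  define d where "d = real DIM('a)"
  define \<rho> where "\<rho> = (2::real) powr (d - q)"
  have "\<rho> < 2 powr 0" unfolding \<rho>_def using assms by (intro powr_less_mono) (auto simp: d_def)
  then have \<rho>: "0 \<le> \<rho>" "\<rho> < 1" by (simp_all add: \<rho>_def)
  have "(\<integral>\<^sup>+x. ennreal ((1 + norm (x::'a)) powr - q) \<partial>lebesgue)
      \<le> ennreal (unit_ball_vol (real DIM('a)) * 2 powr d / (1 - \<rho>))"
  proof (rule nn_integral_le_geometric_balls)
    fix x :: 'a
    show "ennreal ((1 + norm x) powr - q) \<le>
        (\<Sum>k. ennreal ((2 ^ k) powr - q) * indicator (ball 0 (2 ^ Suc k)) x)"
    proof -
      define P where "P k \<longleftrightarrow> 1 + norm x < 2 ^ Suc k" for k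
      obtain k where "1 + norm x < 2 ^ k" using real_arch_pow[of 2 "1 + norm x"] by auto
      moreover have "(2::real) ^ k \<le> 2 ^ Suc k" by simp
      ultimately have "P k" unfolding P_def by linarith
      define j where "j = (LEAST k. P k)"
      have "P j" unfolding j_def by (rule LeastI, fact)
      moreover have "2 ^ j \<le> 1 + norm x"
      proof (cases j)
        case (Suc i)
        then have "\<not> P i" unfolding j_def using not_less_Least[of i P] by auto
        then show ?thesis by (simp add: P_def Suc)
      qed simp
      moreover have "0 < q" using assms by (rule le_less_trans[rotated]) simp
      ultimately have "(1 + norm x) powr - q \<le> (2 ^ j) powr - q" by (intro powr_mono2') auto
      then show ?thesis
        using \<open>P j\<close> by (intro indicator_le_suminf[where k = j]) (auto simp: P_def)
    qed
  next
    fix k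
    have "(2 ^ k) powr - q * (2 ^ Suc k) ^ DIM('a) = (2 ^ k) powr - q * ((2 powr d) * (2 ^ k) powr d)"
      by (simp add: d_def powr_realpow power_mult_distrib)
    also have "\<dots> = 2 powr d * (2 ^ k) powr (d - q)"
      by (simp add: powr_diff powr_minus field_simps)
    also have "(2 ^ k) powr (d - q) = \<rho> ^ k"
      by (simp add: \<rho>_def powr_powr powr_realpow[symmetric] mult.commute)
    finally show "(2 ^ k) powr - q * (2 ^ Suc k) ^ DIM('a) = 2 powr d * \<rho> ^ k" .
  qed (use \<rho> in auto)
  then show "(\<integral>\<^sup>+x. ennreal ((1 + norm (x::'a)) powr - q) \<partial>lebesgue) < \<infinity>"
    by (auto intro: le_less_trans)
qed auto

subsection \<open>Dilations of the interaction energy\<close>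

interpretation lebesgue: sigma_finite_measure "lebesgue :: 'a::euclidean_space measure"
  by (rule sigma_finite_lebesgue)

interpretation lebesgue_pair: pair_sigma_finite "lebesgue :: 'a::euclidean_space measure" "lebesgue :: 'b::euclidean_space measure" ..

lemma integrable_lebesgue_pair_mult:
  fixes f :: "'b::euclidean_space \<Rightarrow> real" and g :: "'a::euclidean_space \<Rightarrow> real"
  assumes "integrable lebesgue f" "integrable lebesgue g"
  shows "integrable (lebesgue \<Otimes>\<^sub>M lebesgue) (\<lambda>(x, y). g x * f y)"
proof (rule lebesgue_pair.Fubini_integrable)
  show "(\<lambda>(x, y). g x * f y) \<in> borel_measurable (lebesgue \<Otimes>\<^sub>M lebesgue)"
    using assms[THEN borel_measurable_integrable] by measurable
  show "integrable lebesgue (\<lambda>x. \<integral>y. norm (case (x, y) of (x, y) \<Rightarrow> g x * f y) \<partial>lebesgue)"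
    using assms by (simp add: abs_mult)
  show "AE x in lebesgue. integrable lebesgue (\<lambda>y. case (x, y) of (x, y) \<Rightarrow> g x * f y)"
    using assms by simp
qed

lemma measurable_fst_lebesgue [measurable]:
  "(\<lambda>p. fst p) \<in> borel_measurable (lebesgue \<Otimes>\<^sub>M M)"
  by (rule measurable_compose[OF measurable_fst measurable_ident_lebesgue_borel])

lemma measurable_snd_lebesgue [measurable]:
  "(\<lambda>p. snd p) \<in> borel_measurable (M \<Otimes>\<^sub>M lebesgue)"
  by (rule measurable_compose[OF measurable_snd measurable_ident_lebesgue_borel])

text \<open>The kernel is differentiated only off the diagonal, whose sections are single
  points.\<close>

lemma AE_lebesgue_pair_neq:
  "AE p in lebesgue \<Otimes>\<^sub>M lebesgue. fst p \<noteq> (snd p :: 'a::euclidean_space)"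
proof (rule lebesgue_pair.AE_pair_measure)
  show "{p \<in> space (lebesgue \<Otimes>\<^sub>M lebesgue). fst p \<noteq> (snd p :: 'a)} \<in> sets (lebesgue \<Otimes>\<^sub>M lebesgue)"
    by measurable
  show "AE x in lebesgue. AE y in lebesgue. fst (x, y) \<noteq> (snd (x, y) :: 'a)"
    using AE_lebesgue_neq by (auto simp: eq_commute)
qed

text \<open>The kernel is the power \<open>a / 2\<close> of a quadratic polynomial in
  \<open>l\<close>, which is positive at \<open>l = 1\<close> off the diagonal, so the chain rule
  applies.\<close>

lemma has_derivative_norm_dilation:
  fixes x y :: "'a::real_inner"
  assumes "x \<noteq> y"
  shows "((\<lambda>l. norm (l *\<^sub>R x - y) powr a) has_real_derivative
    a * ((x - y) \<bullet> (x - y)) powr (a / 2 - 1) * (x \<bullet> (x - y))) (at 1)"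
proof -
  have eq: "norm (l *\<^sub>R x - y) powr a = (l\<^sup>2 * (x \<bullet> x) - 2 * l * (x \<bullet> y) + y \<bullet> y) powr (a / 2)" for l
  proof -
    have "norm (l *\<^sub>R x - y) powr a = ((norm (l *\<^sub>R x - y))\<^sup>2) powr (a / 2)"
      using powr_powr[of "norm (l *\<^sub>R x - y)" 2 "a / 2"] by (cases "l *\<^sub>R x - y = 0") simp_all
    also have "(norm (l *\<^sub>R x - y))\<^sup>2 = l\<^sup>2 * (x \<bullet> x) - 2 * l * (x \<bullet> y) + y \<bullet> y"
      unfolding power2_norm_eq_inner by (simp add: inner_diff_left inner_diff_right inner_commute power2_eq_square algebra_simps)
    finally show ?thesis .
  qed
  have pos: "0 < (x - y) \<bullet> (x - y)" using assms by simp
  have zz: "(x - y) \<bullet> (x - y) = x \<bullet> x - 2 * (x \<bullet> y) + y \<bullet> y"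
    by (simp add: inner_diff_left inner_diff_right inner_commute)
  show ?thesis
    unfolding eq
    using pos unfolding zz
    by (auto intro!: derivative_eq_intros simp: inner_diff_right powr_diff field_simps)
qed

text \<open>The bound does not depend on \<open>h\<close>, as dominated convergence requires. For
  \<open>a < 1\<close> the slope is controlled at the undilated distance and stays singular on the
  diagonal; for \<open>a \<ge> 1\<close> both distances, and \<open>norm x\<close>, are at most
  \<open>2 * ((1 + norm x) * (1 + norm y))\<close>.\<close>

lemma dilation_quotient_le:
  fixes x y :: "'a::euclidean_space"
  assumes a: "0 < a" and h: "h \<noteq> 0" "\<bar>h\<bar> \<le> 1" and "x \<noteq> y"
  shows "\<bar>(norm ((1 + h) *\<^sub>R x - y) powr a - norm (x - y) powr a) / h\<bar> \<le>
    (if a < 1 then norm x * norm (x - y) powr (a - 1)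
     else a * 2 powr a * ((1 + norm x) powr a * (1 + norm y) powr a))"
proof -
  let ?t = "norm ((1 + h) *\<^sub>R x - y)" and ?s = "norm (x - y)"
  have ts: "\<bar>?t - ?s\<bar> \<le> \<bar>h\<bar> * norm x"
  proof -
    have "(1 + h) *\<^sub>R x - y - (x - y) = h *\<^sub>R x" by (simp add: algebra_simps)
    then show ?thesis using norm_triangle_ineq3[of "(1 + h) *\<^sub>R x - y" "x - y"] by simp
  qed
  have "\<bar>?t powr a - ?s powr a\<bar> \<le> \<bar>h\<bar> * (if a < 1 then norm x * norm (x - y) powr (a - 1)
     else a * 2 powr a * ((1 + norm x) powr a * (1 + norm y) powr a))"
  proof (cases "a < 1")
    case True
    have "\<bar>?t powr a - ?s powr a\<bar> \<le> ?s powr (a - 1) * \<bar>?t - ?s\<bar>"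
      using assms True by (intro abs_powr_diff_le_concave) auto
    also have "\<dots> \<le> ?s powr (a - 1) * (\<bar>h\<bar> * norm x)"
      using ts by (intro mult_left_mono) auto
    finally show ?thesis using True by (simp add: mult_ac)
  next
    case False
    let ?m = "2 * ((1 + norm x) * (1 + norm y))"
    have x_le: "norm x \<le> ?m" by (simp add: algebra_simps add_increasing)
    have "?s \<le> norm x + norm y" by norm
    also have "\<dots> \<le> ?m" by (simp add: algebra_simps)
    finally have s: "?s \<le> ?m" .
    have "?t \<le> norm ((1 + h) *\<^sub>R x) + norm y" by (rule norm_triangle_ineq4)
    also have "\<dots> \<le> 2 * norm x + norm y"
      unfolding norm_scaleR using h by (intro add_right_mono mult_right_mono) auto
    also have "2 * norm x + norm y \<le> ?m" by (simp add: algebra_simps)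
    finally have t: "?t \<le> ?m" .
    have "\<bar>?t powr a - ?s powr a\<bar> \<le> a * max ?s ?t powr (a - 1) * \<bar>?t - ?s\<bar>"
      using False by (intro abs_powr_diff_le_convex) auto
    also have "\<dots> \<le> a * ?m powr (a - 1) * (\<bar>h\<bar> * ?m)"
    proof (intro mult_mono)
      show "max ?s ?t powr (a - 1) \<le> ?m powr (a - 1)"
        using False s t by (intro powr_mono2) (auto simp: le_max_iff_disj)
      show "\<bar>?t - ?s\<bar> \<le> \<bar>h\<bar> * ?m"
        using ts mult_left_mono[OF x_le, of "\<bar>h\<bar>"] by linarith
    qed (use False in auto)
    also have "\<dots> = \<bar>h\<bar> * (a * ?m powr a)"
    proof -
      have "0 < ?m" by (simp add: add_pos_nonneg)
      then have "?m powr a = ?m powr (a - 1) * ?m" by (simp add: powr_diff)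
      then show ?thesis by (simp only: mult_ac)
    qed
    also have "?m powr a = 2 powr a * ((1 + norm x) powr a * (1 + norm y) powr a)"
      by (simp add: powr_mult)
    finally show ?thesis using False by (simp add: mult.assoc)
  qed
  then show ?thesis using h by (simp add: abs_divide divide_le_eq mult.commute)
qed

text \<open>The kernel is at most \<open>(1 + \<bar>l\<bar>) powr a\<close> times the product of the
  weights in \<open>x\<close> and \<open>y\<close>, so the majorant is a tensor product of
  integrable functions.\<close>

lemma dilated_energy_integrable:
  fixes f g :: "'a::euclidean_space \<Rightarrow> real"
  assumes a: "0 < a"
    and [measurable]: "f \<in> borel_measurable lebesgue" "g \<in> borel_measurable lebesgue"
    and wf: "integrable lebesgue (\<lambda>y. (1 + norm y) powr a * f y)"
    and wg: "integrable lebesgue (\<lambda>x. (1 + norm x) powr a * g x)"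
  shows "integrable (lebesgue \<Otimes>\<^sub>M lebesgue) (\<lambda>(x, y). norm (l *\<^sub>R x - y) powr a * (f y * g x))"
proof -
  have "integrable (lebesgue \<Otimes>\<^sub>M lebesgue)
      (\<lambda>p. (1 + \<bar>l\<bar>) powr a * (case p of (x, y) \<Rightarrow> ((1 + norm x) powr a * g x) * ((1 + norm y) powr a * f y)))"
    by (intro integrable_mult_right integrable_lebesgue_pair_mult wf wg)
  then show ?thesis
  proof (rule Bochner_Integration.integrable_bound)
    have "\<bar>norm (l *\<^sub>R x - y) powr a * (f y * g x)\<bar> \<le>
        \<bar>(1 + \<bar>l\<bar>) powr a * (((1 + norm x) powr a * g x) * ((1 + norm y) powr a * f y))\<bar>" for x y
    proof -
      have "norm (l *\<^sub>R x - y) \<le> \<bar>l\<bar> * norm x + norm y"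
        using norm_triangle_ineq4[of "l *\<^sub>R x" y] by simp
      also have "\<dots> \<le> (1 + \<bar>l\<bar>) * ((1 + norm x) * (1 + norm y))"
        by (simp add: algebra_simps)
      finally have "norm (l *\<^sub>R x - y) powr a \<le> ((1 + \<bar>l\<bar>) * ((1 + norm x) * (1 + norm y))) powr a"
        using a by (intro powr_mono2) auto
      also have "\<dots> = (1 + \<bar>l\<bar>) powr a * ((1 + norm x) powr a * (1 + norm y) powr a)"
        by (simp add: powr_mult)
      finally have "norm (l *\<^sub>R x - y) powr a * \<bar>f y * g x\<bar> \<le> \<dots> * \<bar>f y * g x\<bar>"
        by (intro mult_right_mono) auto
      then show ?thesis by (simp add: abs_mult mult_ac)
    qed
    then show "AE p in lebesgue \<Otimes>\<^sub>M lebesgue.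
        norm (case p of (x, y) \<Rightarrow> norm (l *\<^sub>R x - y) powr a * (f y * g x)) \<le>
        norm ((1 + \<bar>l\<bar>) powr a * (case p of (x, y) \<Rightarrow> ((1 + norm x) powr a * g x) * ((1 + norm y) powr a * f y)))"
      by (intro AE_I2) auto
  qed measurable
qed

text \<open>Differentiation under the integral sign, by dominated convergence along every sequence
  of increments tending to \<open>0\<close>. For \<open>a < 1\<close> the majorant is the singular
  energy assumed in \<open>sing\<close>.\<close>

lemma dilated_energy_differentiable:
  fixes f g :: "'a::euclidean_space \<Rightarrow> real"
  assumes a: "0 < a"
    and [measurable]: "f \<in> borel_measurable lebesgue" "g \<in> borel_measurable lebesgue"
    and wf: "integrable lebesgue (\<lambda>y. (1 + norm y) powr a * f y)"
    and wg: "integrable lebesgue (\<lambda>x. (1 + norm x) powr a * g x)"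
    and sing: "a < 1 \<Longrightarrow> integrable (lebesgue \<Otimes>\<^sub>M lebesgue)
      (\<lambda>(x, y). norm x * norm (x - y) powr (a - 1) * (f y * g x))"
  shows "\<exists>D. ((\<lambda>l. \<integral>(x, y). norm (l *\<^sub>R x - y) powr a * (f y * g x) \<partial>(lebesgue \<Otimes>\<^sub>M lebesgue))
    has_real_derivative D) (at 1)"
proof -
  let ?L = "lebesgue \<Otimes>\<^sub>M lebesgue :: ('a \<times> 'a) measure"
  define J where "J l = (\<integral>(x, y). norm (l *\<^sub>R x - y) powr a * (f y * g x) \<partial>?L)" for l
  define d where "d p = (case p of (x, y) \<Rightarrow>
      a * ((x - y) \<bullet> (x - y)) powr (a / 2 - 1) * (x \<bullet> (x - y)) * (f y * g x))" for p :: "'a \<times> 'a"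
  define s where "s h p = (case p of (x, y) \<Rightarrow>
      (norm ((1 + h) *\<^sub>R x - y) powr a - norm (x - y) powr a) / h * (f y * g x))"
    for h and p :: "'a \<times> 'a"
  \<comment> \<open>The majorant of the difference quotients; absolute values appear because
    \<open>f\<close> and \<open>g\<close> may have any sign here.\<close>
  define w where "w p = (case p of (x, y) \<Rightarrow>
      if a < 1 then norm x * norm (x - y) powr (a - 1) * \<bar>f y * g x\<bar>
      else a * 2 powr a * \<bar>((1 + norm x) powr a * g x) * ((1 + norm y) powr a * f y)\<bar>)" for p :: "'a \<times> 'a"
  have int: "integrable ?L (\<lambda>(x, y). norm (l *\<^sub>R x - y) powr a * (f y * g x))" for l
    by (rule dilated_energy_integrable) fact+
  have quot: "(J (1 + h) - J 1) / h = (\<integral>p. s h p \<partial>?L)" for h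
  proof -
    have "(J (1 + h) - J 1) / h = (\<integral>p. ((case p of (x, y) \<Rightarrow> norm ((1 + h) *\<^sub>R x - y) powr a * (f y * g x))
        - (case p of (x, y) \<Rightarrow> norm (1 *\<^sub>R x - y) powr a * (f y * g x))) / h \<partial>?L)"
      unfolding J_def by (simp only: Bochner_Integration.integral_diff[OF int int] integral_divide_zero)
    also have "\<dots> = (\<integral>p. s h p \<partial>?L)"
      by (intro Bochner_Integration.integral_cong) (auto simp: s_def algebra_simps diff_divide_distrib)
    finally show ?thesis .
  qed
  have w: "integrable ?L w"
  proof (cases "a < 1")
    case True
    have "w = (\<lambda>p. \<bar>case p of (x, y) \<Rightarrow> norm x * norm (x - y) powr (a - 1) * (f y * g x)\<bar>)"
      using True by (auto simp: w_def abs_mult)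
    then show ?thesis using integrable_abs[OF sing[OF True]] by simp
  next
    case False
    have "w = (\<lambda>p. a * 2 powr a * \<bar>case p of (x, y) \<Rightarrow> ((1 + norm x) powr a * g x) * ((1 + norm y) powr a * f y)\<bar>)"
      using False by (auto simp: w_def)
    then show ?thesis
      using integrable_mult_right[OF integrable_abs[OF integrable_lebesgue_pair_mult[OF wf wg]]] by simp
  qed
  have "(\<lambda>h. (J (1 + h) - J 1) / h) \<midarrow>0\<rightarrow> (\<integral>p. d p \<partial>?L)"
    unfolding LIMSEQ_SEQ_conv[symmetric]
  proof (intro allI impI)
    fix S :: "nat \<Rightarrow> real"
    assume S: "(\<forall>n. S n \<noteq> 0) \<and> S \<longlonglongrightarrow> 0"
    then have "\<forall>\<^sub>F n in sequentially. \<bar>S n\<bar> < 1"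
      using tendsto_rabs[of S 0] by (intro order_tendstoD(2)[of "\<lambda>n. \<bar>S n\<bar>" 0]) auto
    \<comment> \<open>Dropping the first \<open>N\<close> terms secures
      \<open>\<bar>h\<bar> \<le> 1\<close>, which the quotient bound demands.\<close>
    then obtain N where N: "\<And>n. \<bar>S (n + N)\<bar> < 1"
      unfolding eventually_sequentially by (metis le_add2)
    have "(\<lambda>n. \<integral>p. s (S (n + N)) p \<partial>?L) \<longlonglongrightarrow> (\<integral>p. d p \<partial>?L)"
    proof (rule integral_dominated_convergence[where w = w])
      show "d \<in> borel_measurable ?L" unfolding d_def by measurable
      show "s (S (n + N)) \<in> borel_measurable ?L" for n unfolding s_def by measurable
      show "AE p in ?L. (\<lambda>n. s (S (n + N)) p) \<longlonglongrightarrow> d p"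
        using AE_lebesgue_pair_neq
      proof eventually_elim
        case (elim p)
        obtain x y where p: "p = (x, y)" by (cases p)
        have lim: "(\<lambda>h. (norm ((1 + h) *\<^sub>R x - y) powr a - norm (x - y) powr a) / h) \<midarrow>0\<rightarrow>
            a * ((x - y) \<bullet> (x - y)) powr (a / 2 - 1) * (x \<bullet> (x - y))"
          using has_derivative_norm_dilation[of x y a] elim unfolding p DERIV_def by simp
        have "(\<forall>n. S (n + N) \<noteq> 0) \<and> (\<lambda>n. S (n + N)) \<longlonglongrightarrow> 0"
          using S LIMSEQ_ignore_initial_segment[of S 0 N] by simp
        then have "(\<lambda>n. (norm ((1 + S (n + N)) *\<^sub>R x - y) powr a - norm (x - y) powr a) / S (n + N)) \<longlonglongrightarrow>
            a * ((x - y) \<bullet> (x - y)) powr (a / 2 - 1) * (x \<bullet> (x - y))"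
          by (rule LIMSEQ_SEQ_conv[THEN iffD2, OF lim, THEN spec[where x = "\<lambda>n. S (n + N)"], THEN mp])
        then show ?case unfolding p d_def s_def prod.case by (intro tendsto_mult_right)
      qed
      show "AE p in ?L. norm (s (S (n + N)) p) \<le> w p" for n
        using AE_lebesgue_pair_neq
      proof eventually_elim
        case (elim p)
        obtain x y where p: "p = (x, y)" by (cases p)
        have "\<bar>(norm ((1 + S (n + N)) *\<^sub>R x - y) powr a - norm (x - y) powr a) / S (n + N)\<bar> * \<bar>f y * g x\<bar> \<le>
          (if a < 1 then norm x * norm (x - y) powr (a - 1)
           else a * 2 powr a * ((1 + norm x) powr a * (1 + norm y) powr a)) * \<bar>f y * g x\<bar>"
          using elim N[of n] S a unfolding p
          by (intro mult_right_mono dilation_quotient_le) auto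
        then show ?case unfolding p s_def w_def by (simp add: abs_mult mult_ac split: if_splits)
      qed
    qed (rule w)
    then show "(\<lambda>n. (J (1 + S n) - J 1) / S n) \<longlonglongrightarrow> (\<integral>p. d p \<partial>?L)"
      unfolding quot by (rule LIMSEQ_offset)
  qed
  then have "(J has_real_derivative (\<integral>p. d p \<partial>?L)) (at 1)" by (simp add: DERIV_def)
  then show ?thesis unfolding J_def[abs_def] by blast
qed

section \<open>Finite weighted mass: decay and the singular energy\<close>

lemma ball_mass_le_integral:
  fixes h :: "'a::euclidean_space \<Rightarrow> real"
  assumes h: "integrable lebesgue h" and nonneg: "\<And>x. 0 \<le> h x"
    and "\<And>x. x \<in> ball c r \<Longrightarrow> t \<le> h x" and "0 \<le> r"
  shows "t * (unit_ball_vol (real DIM('a)) * r ^ DIM('a)) \<le> (\<integral>x. h x \<partial>lebesgue)"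
proof -
  have "t * (unit_ball_vol (real DIM('a)) * r ^ DIM('a)) = (\<integral>x. t * indicator (ball c r) x \<partial>lebesgue)"
    using \<open>0 \<le> r\<close> by (simp add: content_ball)
  also have "\<dots> \<le> (\<integral>x. h x \<partial>lebesgue)"
    using assms by (intro integral_mono integrable_mult_right integrable_real_indicator)
      (auto simp: indicator_def emeasure_ball)
  finally show ?thesis .
qed

text \<open>Arbitrarily large balls fit outside the unit ball, so a positive lower bound there would
  force infinite mass.\<close>

lemma not_integrable_bounded_below:
  fixes h :: "'a::euclidean_space \<Rightarrow> real"
  assumes h: "integrable lebesgue h" and nonneg: "\<And>x. 0 \<le> h x"
    and ge: "\<And>x. 1 \<le> norm x \<Longrightarrow> t \<le> h x"
  shows "t \<le> 0"
proof (rule ccontr)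
  assume "\<not> t \<le> 0"
  define V where "V = unit_ball_vol (real DIM('a))"
  have "0 < t * V" using \<open>\<not> t \<le> 0\<close> by (simp add: V_def)
  obtain e :: 'a where e: "e \<in> Basis" using nonempty_Basis by blast
  define I where "I = (\<integral>x. h x \<partial>lebesgue)"
  \<comment> \<open>Chosen so that \<open>t * V * r = t * V + \<bar>I\<bar>\<close> exceeds
    \<open>I\<close>; since \<open>r \<ge> 1\<close>, raising \<open>r\<close> to the dimension only
    enlarges the mass.\<close>
  define r where "r = 1 + \<bar>I\<bar> / (t * V)"
  have r: "1 \<le> r" using \<open>0 < t * V\<close> by (simp add: r_def)
  have "t \<le> h x" if "x \<in> ball ((1 + r) *\<^sub>R e) r" for x
  proof (rule ge)
    have "norm ((1 + r) *\<^sub>R e) = 1 + r" using e r by simp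
    then show "1 \<le> norm x"
      using that norm_triangle_ineq2[of "(1 + r) *\<^sub>R e" x] by (simp add: dist_norm)
  qed
  from ball_mass_le_integral[OF h nonneg this] r
  have "t * (V * r ^ DIM('a)) \<le> I" by (simp add: V_def I_def)
  moreover have "r ^ 1 \<le> r ^ DIM('a)"
    using r by (intro power_increasing) (auto simp: Suc_leI)
  then have "t * V * r \<le> t * V * r ^ DIM('a)"
    using \<open>0 < t * V\<close> by (intro mult_left_mono) auto
  moreover have "t * V * r = t * V + t * V * (\<bar>I\<bar> / (t * V))"
    by (simp only: r_def distrib_left mult_1_right)
  moreover have "t * V * (\<bar>I\<bar> / (t * V)) = \<bar>I\<bar>"
    using \<open>0 < t * V\<close> by (metis less_irrefl nonzero_mult_div_cancel_left times_divide_eq_right)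
  ultimately show False using \<open>0 < t * V\<close> by (simp add: mult.assoc)
qed

text \<open>The weighted density is bounded below by a radial power that does not increase, as
  \<open>p \<ge> 1\<close>. Its integral over the ball of radius \<open>norm x\<close> is therefore
  at least its boundary value times the volume, which turns finite mass into pointwise
  decay.\<close>

lemma decay_of_weight_integrable:
  fixes g :: "'a::euclidean_space \<Rightarrow> real"
  assumes a: "0 < a" and p: "1 \<le> p" and c: "0 < c" and C: "0 \<le> C"
    and wg: "integrable lebesgue (\<lambda>x. (1 + norm x) powr a * g x)"
    and lower: "\<And>x. c * (1 + norm x) powr (- a * p) \<le> g x"
    and upper: "\<And>x. g x \<le> C * (1 + norm x) powr (- a * p)"
  obtains B where "0 \<le> B" "\<And>x. norm x powr (real DIM('a) + a) * g x \<le> B"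
proof -
  define I where "I = (\<integral>x. (1 + norm x) powr a * g x \<partial>lebesgue)"
  define V where "V = unit_ball_vol (real DIM('a))"
  have V: "0 < V" by (simp add: V_def)
  have g: "0 \<le> g x" for x
    by (rule order_trans[OF _ lower]) (use c in simp)
  have I: "0 \<le> I" unfolding I_def by (intro Bochner_Integration.integral_nonneg) (simp add: g)
  have le: "norm x powr real DIM('a) * (1 + norm x) powr (a - a * p) \<le> I / (c * V)" for x :: 'a
  proof (cases "x = 0")
    case True
    then show ?thesis using I c V by simp
  next
    case False
    let ?R = "norm x"
    have "c * (1 + ?R) powr (a - a * p) \<le> (1 + norm z) powr a * g z" if "z \<in> ball 0 ?R" for z
    proof -
      have "(1 + ?R) powr (a - a * p) \<le> (1 + norm z) powr (a - a * p)"
        using that a p by (intro powr_mono2') (auto simp: add_pos_nonneg)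
      then have "c * (1 + ?R) powr (a - a * p) \<le> c * (1 + norm z) powr (a - a * p)"
        using c by (intro mult_left_mono) auto
      also have "\<dots> = (1 + norm z) powr a * (c * (1 + norm z) powr (- a * p))"
        using powr_add[of "1 + norm z" a "- a * p"] by simp
      also have "\<dots> \<le> (1 + norm z) powr a * g z"
        by (intro mult_left_mono lower) auto
      finally show ?thesis .
    qed
    then have "c * (1 + ?R) powr (a - a * p) * (V * ?R ^ DIM('a)) \<le> I"
      unfolding V_def I_def by (intro ball_mass_le_integral[OF wg, of 0]) (simp_all add: g)
    moreover have "?R powr real DIM('a) = ?R ^ DIM('a)" using False by (simp add: powr_realpow)
    ultimately show ?thesis using c V by (simp add: field_simps)
  qed
  have "norm x powr (real DIM('a) + a) * g x \<le> C * (I / (c * V))" for x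
  proof -
    have "norm x powr a \<le> (1 + norm x) powr a" using a by (intro powr_mono2) auto
    then have "norm x powr (real DIM('a) + a) * g x \<le>
        (norm x powr real DIM('a) * (1 + norm x) powr a) * (C * (1 + norm x) powr (- a * p))"
      unfolding powr_add by (intro mult_mono upper mult_left_mono) (auto simp: g)
    also have "\<dots> = C * (norm x powr real DIM('a) * (1 + norm x) powr (a - a * p))"
      using powr_add[of "1 + norm x" a "- a * p"] by simp
    also have "\<dots> \<le> C * (I / (c * V))" using C le by (intro mult_left_mono) auto
    finally show ?thesis .
  qed
  moreover have "0 \<le> C * (I / (c * V))" using C I c V by simp
  ultimately show ?thesis using that by blast
qed

text \<open>If \<open>norm (x - y) \<ge> norm x / 2\<close>, the kernel is at most
  \<open>2 * norm x powr (a - 1)\<close> and the weight absorbs it. Otherwise \<open>x\<close> and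
  \<open>y\<close> have comparable norms, and the decay of \<open>g\<close> is expressed through
  \<open>norm y\<close>.\<close>

lemma singular_kernel_le:
  fixes x y :: "'a::euclidean_space"
  assumes a: "0 < a" "a < 1" and g: "0 \<le> g"
    and decay: "norm x powr (real DIM('a) + a) * g \<le> B" and B: "0 \<le> B"
  defines "\<delta> \<equiv> 1 - real DIM('a) - a"
  shows "norm x * norm (x - y) powr (a - 1) * g \<le> 2 * ((1 + norm x) powr a * g) +
    B * (2/3) powr \<delta> * norm y powr \<delta> * (indicator (ball y (norm y)) x * norm (x - y) powr (a - 1))"
proof (cases "x = 0")
  case True
  then show ?thesis using B g by (auto simp: indicator_def)
next
  case False
  then have x: "0 < norm x" by simp
  have \<delta>: "\<delta> \<le> 0" using a by (simp add: \<delta>_def) (use DIM_ge_Suc0[where 'a='a] in linarith)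
  show ?thesis
  proof (cases "norm x / 2 \<le> norm (x - y)")
    case True
    have "norm (x - y) powr (a - 1) \<le> (norm x / 2) powr (a - 1)"
      using True x a by (intro powr_mono2') auto
    also have "\<dots> = 2 powr (1 - a) * norm x powr (a - 1)"
      by (simp add: powr_divide powr_diff)
    also have "\<dots> \<le> 2 powr 1 * norm x powr (a - 1)"
      using a by (intro mult_right_mono powr_mono) auto
    finally have "norm x * norm (x - y) powr (a - 1) \<le> norm x * (2 * norm x powr (a - 1))"
      by (intro mult_left_mono) auto
    also have "\<dots> = 2 * norm x powr a" using x by (simp add: powr_diff)
    also have "\<dots> \<le> 2 * (1 + norm x) powr a" using a by (intro mult_left_mono powr_mono2) auto
    finally have "norm x * norm (x - y) powr (a - 1) * g \<le> 2 * (1 + norm x) powr a * g"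
      using g by (intro mult_right_mono)
    moreover have "0 \<le> B * (2/3) powr \<delta> * norm y powr \<delta> *
        (indicator (ball y (norm y)) x * norm (x - y) powr (a - 1))"
      using B by (auto simp: indicator_def)
    ultimately show ?thesis by simp
  next
    case near: False
    \<comment> \<open>Here \<open>norm y > norm x / 2 > norm (x - y)\<close>. The second bound
      yields the factor \<open>(2/3) powr \<delta>\<close>, the exponent \<open>\<delta>\<close>
      being nonpositive.\<close>
    have y: "norm (x - y) < norm y" "norm y \<le> 3/2 * norm x"
      using near norm_triangle_ineq2[of x y] norm_triangle_ineq2[of y x] by (auto simp: norm_minus_commute)
    have "norm y > 0" using y(1) by (meson norm_ge_zero le_less_trans)
    have "norm x * g = norm x powr \<delta> * (norm x powr (real DIM('a) + a) * g)"
      using x by (simp add: \<delta>_def flip: powr_add mult.assoc)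
    also have "\<dots> \<le> norm x powr \<delta> * B" by (intro mult_left_mono decay) auto
    also have "\<dots> \<le> (2/3 * norm y) powr \<delta> * B"
      using y \<open>norm y > 0\<close> \<delta> B by (intro mult_right_mono powr_mono2') auto
    also have "\<dots> = B * (2/3) powr \<delta> * norm y powr \<delta>"
      using powr_mult[of "2/3" "norm y" \<delta>] by simp
    finally have "norm x * g * norm (x - y) powr (a - 1) \<le>
        B * (2/3) powr \<delta> * norm y powr \<delta> * norm (x - y) powr (a - 1)"
      by (intro mult_right_mono) auto
    moreover have "0 \<le> 2 * ((1 + norm x) powr a * g)" using g by simp
    moreover have "x \<in> ball y (norm y)" using y by (simp add: dist_norm norm_minus_commute)
    ultimately show ?thesis by (simp add: mult_ac)
  qed
qed

text \<open>Integrating in \<open>x\<close> first gives a bound uniform in \<open>y\<close>, after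
  which integrability of \<open>f\<close> finishes.\<close>

lemma singular_energy_integrable:
  fixes f g :: "'a::euclidean_space \<Rightarrow> real"
  assumes a: "0 < a" "a < 1"
    and [measurable]: "f \<in> borel_measurable lebesgue" "g \<in> borel_measurable lebesgue"
    and f: "integrable lebesgue f" "\<And>y. 0 \<le> f y" and g: "\<And>x. 0 \<le> g x"
    and wg: "integrable lebesgue (\<lambda>x. (1 + norm x) powr a * g x)"
    and B: "0 \<le> B" and decay: "\<And>x. norm x powr (real DIM('a) + a) * g x \<le> B"
  shows "integrable (lebesgue \<Otimes>\<^sub>M lebesgue)
    (\<lambda>(x, y). norm x * norm (x - y) powr (a - 1) * (f y * g x))"
proof (rule integrableI_nonneg)
  let ?k = "\<lambda>x y :: 'a. norm x * norm (x - y) powr (a - 1) * g x"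
  define \<delta> where "\<delta> = 1 - real DIM('a) - a"
  define W where "W = (\<integral>x. (1 + norm x) powr a * g x \<partial>lebesgue)"
  define E where "E = B * (2/3) powr \<delta>"
  have "0 \<le> E" using B by (simp add: E_def)
  have "0 \<le> W" unfolding W_def by (intro Bochner_Integration.integral_nonneg) (simp add: g)
  have "a - 1 \<le> 0" "- real DIM('a) < a - 1" using a DIM_ge_Suc0[where 'a='a] by linarith+
  then obtain K where K: "0 \<le> K" "\<And>(y::'a) R. 0 \<le> R \<Longrightarrow>
      (\<integral>\<^sup>+x. ennreal (indicator (ball y R) x * norm (x - y) powr (a - 1)) \<partial>lebesgue)
        \<le> ennreal (K * R powr (a - 1 + real DIM('a)))"
    using nn_integral_norm_powr_ball by blast
  have inner: "(\<integral>\<^sup>+x. ennreal (?k x y) \<partial>lebesgue) \<le> ennreal (2 * W + E * K)" for y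
  proof -
    have "(\<integral>\<^sup>+x. ennreal (?k x y) \<partial>lebesgue) \<le> (\<integral>\<^sup>+x. ennreal (2 * ((1 + norm x) powr a * g x)) +
        ennreal (E * norm y powr \<delta>) * ennreal (indicator (ball y (norm y)) x * norm (x - y) powr (a - 1)) \<partial>lebesgue)"
    proof (intro nn_integral_mono)
      fix x
      have "ennreal (?k x y) \<le> ennreal (2 * ((1 + norm x) powr a * g x) +
          E * norm y powr \<delta> * (indicator (ball y (norm y)) x * norm (x - y) powr (a - 1)))"
        unfolding E_def \<delta>_def by (intro ennreal_leI singular_kernel_le a g decay B)
      also have "\<dots> = ennreal (2 * ((1 + norm x) powr a * g x)) +
        ennreal (E * norm y powr \<delta>) * ennreal (indicator (ball y (norm y)) x * norm (x - y) powr (a - 1))"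
        using g[of x] \<open>0 \<le> E\<close> by (simp add: ennreal_plus ennreal_mult)
      finally show "ennreal (?k x y) \<le> ennreal (2 * ((1 + norm x) powr a * g x)) +
        ennreal (E * norm y powr \<delta>) * ennreal (indicator (ball y (norm y)) x * norm (x - y) powr (a - 1))" .
    qed
    also have "\<dots> = (\<integral>\<^sup>+x. ennreal (2 * ((1 + norm x) powr a * g x)) \<partial>lebesgue) +
        ennreal (E * norm y powr \<delta>) *
        (\<integral>\<^sup>+x. ennreal (indicator (ball y (norm y)) x * norm (x - y) powr (a - 1)) \<partial>lebesgue)"
    proof -
      have m: "(\<lambda>x. ennreal (indicator (ball y (norm y)) x * norm (x - y) powr (a - 1))) \<in> borel_measurable lebesgue"
        by (intro measurable_compose[OF _ measurable_ennreal] borel_measurable_times borel_measurable_indicator)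
          (simp, measurable)
      show ?thesis
        by (subst nn_integral_add) (use m in \<open>auto simp: nn_integral_cmult\<close>)
    qed
    also have "(\<integral>\<^sup>+x. ennreal (2 * ((1 + norm x) powr a * g x)) \<partial>lebesgue) = ennreal (2 * W)"
      unfolding W_def using wg g by (subst nn_integral_eq_integral) auto
    also have "ennreal (2 * W) + ennreal (E * norm y powr \<delta>) *
        (\<integral>\<^sup>+x. ennreal (indicator (ball y (norm y)) x * norm (x - y) powr (a - 1)) \<partial>lebesgue) \<le>
        ennreal (2 * W) + ennreal (E * norm y powr \<delta>) * ennreal (K * norm y powr (a - 1 + real DIM('a)))"
      by (intro add_left_mono mult_left_mono K) auto
    also have "\<dots> = ennreal (2 * W + E * norm y powr \<delta> * (K * norm y powr (a - 1 + real DIM('a))))"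
      using \<open>0 \<le> E\<close> \<open>0 \<le> K\<close> \<open>0 \<le> W\<close> by (simp add: ennreal_plus ennreal_mult)
    also have "\<dots> \<le> ennreal (2 * W + E * K)"
    proof -
      \<comment> \<open>The exponents cancel exactly. The product is \<open>1\<close> off the origin
        and \<open>0\<close> at \<open>y = 0\<close>, where \<open>0 powr 0 = 0\<close>.\<close>
      have "norm y powr \<delta> * norm y powr (a - 1 + real DIM('a)) \<le> 1"
        unfolding powr_add[symmetric] by (simp add: \<delta>_def)
      from mult_left_mono[OF this, of "E * K"] show ?thesis
        using \<open>0 \<le> E\<close> \<open>0 \<le> K\<close> by (intro ennreal_leI) (simp add: mult_ac)
    qed
    finally show ?thesis .
  qed
  have m: "(\<lambda>p. ennreal (case p of (x, y) \<Rightarrow> norm x * norm (x - y) powr (a - 1) * (f y * g x)))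
      \<in> borel_measurable (lebesgue \<Otimes>\<^sub>M lebesgue)"
    by measurable
  have "(\<integral>\<^sup>+p. ennreal (case p of (x, y) \<Rightarrow> norm x * norm (x - y) powr (a - 1) * (f y * g x)) \<partial>(lebesgue \<Otimes>\<^sub>M lebesgue)) =
      (\<integral>\<^sup>+y. \<integral>\<^sup>+x. ennreal (norm x * norm (x - y) powr (a - 1) * (f y * g x)) \<partial>lebesgue \<partial>lebesgue)"
    using lebesgue_pair.nn_integral_snd[OF m] by simp
  also have "\<dots> \<le> (\<integral>\<^sup>+y. ennreal (f y) * ennreal (2 * W + E * K) \<partial>lebesgue)"
  proof (intro nn_integral_mono)
    fix y
    have "(\<integral>\<^sup>+x. ennreal (norm x * norm (x - y) powr (a - 1) * (f y * g x)) \<partial>lebesgue) =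
        (\<integral>\<^sup>+x. ennreal (f y) * ennreal (?k x y) \<partial>lebesgue)"
      using f g by (intro nn_integral_cong) (simp add: mult_ac flip: ennreal_mult)
    also have "\<dots> = ennreal (f y) * (\<integral>\<^sup>+x. ennreal (?k x y) \<partial>lebesgue)"
      by (intro nn_integral_cmult) measurable
    also have "\<dots> \<le> ennreal (f y) * ennreal (2 * W + E * K)"
      by (intro mult_left_mono inner) auto
    finally show "(\<integral>\<^sup>+x. ennreal (norm x * norm (x - y) powr (a - 1) * (f y * g x)) \<partial>lebesgue) \<le>
        ennreal (f y) * ennreal (2 * W + E * K)" .
  qed
  also have "\<dots> = (\<integral>\<^sup>+y. ennreal (f y) \<partial>lebesgue) * ennreal (2 * W + E * K)"
    by (intro nn_integral_multc) measurable
  also have "\<dots> < \<infinity>"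
    using f by (subst nn_integral_eq_integral) (auto simp: ennreal_mult_less_top)
  finally show "(\<integral>\<^sup>+p. ennreal (case p of (x, y) \<Rightarrow> norm x * norm (x - y) powr (a - 1) * (f y * g x))
      \<partial>(lebesgue \<Otimes>\<^sub>M lebesgue)) < \<infinity>" .
next
  show "(\<lambda>(x, y). norm x * norm (x - y) powr (a - 1) * (f y * g x)) \<in> borel_measurable (lebesgue \<Otimes>\<^sub>M lebesgue)"
    by measurable
qed (use f g in auto)

section \<open>Minorants of the energy from convexity\<close>

text \<open>With \<open>r = U (l *\<^sub>R x) / U x\<close>, the tangent bound for
  \<open>r powr (1 - p)\<close> reads \<open>r \<ge> 1 + (1 - r powr (1 - p)) / (p - 1)\<close>.
  Multiplied by \<open>U x powr (1 - p)\<close>, every term on the right integrates explicitly, the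
  last one by scaling.\<close>

lemma dilation_tangent_bound:
  fixes U :: "'a::euclidean_space \<Rightarrow> real"
  assumes p: "1 < p" and [measurable]: "U \<in> borel_measurable lebesgue" and pos: "\<And>x. x \<noteq> 0 \<Longrightarrow> 0 < U x"
    and A: "integrable lebesgue (\<lambda>x. U x powr (1 - p))" and "0 < l"
    and int: "integrable lebesgue (\<lambda>x. U (l *\<^sub>R x) * U x powr - p)"
  defines "A \<equiv> \<integral>x. U x powr (1 - p) \<partial>lebesgue"
  shows "A + (1 - l powr - real DIM('a)) * A / (p - 1) \<le> (\<integral>x. U (l *\<^sub>R x) * U x powr - p \<partial>lebesgue)"
proof -
  note sc = integral_lebesgue_scaleR[OF \<open>0 < l\<close>, of "\<lambda>x. U x powr (1 - p)"]
  have intl: "integrable lebesgue (\<lambda>x. U (l *\<^sub>R x) powr (1 - p))" using sc(1)[OF _ A] by simp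
  have "A + (1 - l powr - real DIM('a)) * A / (p - 1) =
      (\<integral>x. U x powr (1 - p) + (U x powr (1 - p) - U (l *\<^sub>R x) powr (1 - p)) / (p - 1) \<partial>lebesgue)"
    using sc(2) A intl by (simp add: A_def algebra_simps)
  also have "\<dots> \<le> (\<integral>x. U (l *\<^sub>R x) * U x powr - p \<partial>lebesgue)"
  proof (rule integral_mono_AE)
    show "AE x in lebesgue. U x powr (1 - p) + (U x powr (1 - p) - U (l *\<^sub>R x) powr (1 - p)) / (p - 1)
        \<le> U (l *\<^sub>R x) * U x powr - p"
      using AE_lebesgue_neq[of 0]
    proof eventually_elim
      case (elim x)
      then have U: "0 < U x" "0 < U (l *\<^sub>R x)" using \<open>0 < l\<close> pos by auto
      define r where "r = U (l *\<^sub>R x) / U x"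
      have r: "0 < r" "U (l *\<^sub>R x) = r * U x" using U by (auto simp: r_def)
      have "1 + (1 - p) * (r - 1) \<le> r powr (1 - p)"
        using r p by (intro powr_ge_tangent_line) auto
      then have "1 + (1 - r powr (1 - p)) / (p - 1) \<le> r" using p by (simp add: field_simps)
      then have "(1 + (1 - r powr (1 - p)) / (p - 1)) * U x powr (1 - p) \<le> r * U x powr (1 - p)"
        by (intro mult_right_mono) auto
      moreover have "r * U x powr (1 - p) = U (l *\<^sub>R x) * U x powr - p"
        using U r by (simp add: powr_diff powr_minus field_simps)
      moreover have "r powr (1 - p) * U x powr (1 - p) = U (l *\<^sub>R x) powr (1 - p)"
        using r by (simp add: powr_mult)
      ultimately show ?case by (simp add: algebra_simps add_divide_distrib diff_divide_distrib)
    qed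
  qed (use A intl int in auto)
  finally show ?thesis .
qed

text \<open>A differentiable minorant that meets \<open>J\<close> at \<open>1\<close> has the same
  derivative there, since the difference has a minimum. Two such minorants must share the slope
  \<open>D\<close>.\<close>

lemma touching_slopes_eq:
  fixes J :: "real \<Rightarrow> real"
  assumes J: "(J has_real_derivative D) (at 1)" "J 1 = A" and "A \<noteq> 0" "q1 \<noteq> 0" "q2 \<noteq> 0"
    and lower1: "\<And>l. 0 < l \<Longrightarrow> A + (1 - l powr - d) * A / q1 \<le> J l"
    and lower2: "\<And>l. 0 < l \<Longrightarrow> l powr b * (A + (1 - l powr d) * A / q2) \<le> J l"
  shows "d / q1 + d / q2 = b"
proof -
  have eq: "D = S" if "(\<phi> has_real_derivative S) (at 1)" "\<phi> 1 = A" "\<And>l. 0 < l \<Longrightarrow> \<phi> l \<le> J l" for \<phi> S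
  proof -
    have "((\<lambda>l. J l - \<phi> l) has_real_derivative D - S) (at 1)"
      using J that by (intro derivative_intros)
    \<comment> \<open>Radius \<open>1\<close> keeps \<open>l\<close> positive, the range where the
      minorants are known.\<close>
    moreover have "\<forall>l. \<bar>1 - l\<bar> < 1 \<longrightarrow> J 1 - \<phi> 1 \<le> J l - \<phi> l"
      using that J by auto
    ultimately show ?thesis using DERIV_local_min[of _ "D - S" 1 1] by force
  qed
  have "D = d * A / q1"
    by (rule eq[where \<phi> = "\<lambda>l. A + (1 - l powr - d) * A / q1"])
      (use lower1 \<open>q1 \<noteq> 0\<close> in \<open>auto intro!: derivative_eq_intros\<close>)
  moreover have "D = b * A - d * A / q2"
    by (rule eq[where \<phi> = "\<lambda>l. l powr b * (A + (1 - l powr d) * A / q2)"])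
      (use lower2 \<open>q2 \<noteq> 0\<close> in \<open>auto intro!: derivative_eq_intros\<close>)
  ultimately have "(d / q1 + d / q2) * A = b * A" by (simp add: algebra_simps)
  then show ?thesis using \<open>A \<noteq> 0\<close> by simp
qed

section \<open>Two-sided bounds and integrability of reciprocals\<close>

lemma comparableI:
  assumes m: "0 < m" and bounds: "eventually (\<lambda>x. 0 \<le> g x \<and> m * g x \<le> f x \<and> f x \<le> M * g x) F"
  shows "comparable f g F"
proof -
  define C where "C = max 1 (max (inverse m) M)"
  have C: "1 \<le> C" "M \<le> C" "inverse m \<le> C" by (simp_all add: C_def)
  have "inverse C \<le> inverse (inverse m)" using C m by (intro le_imp_inverse_le) auto
  then have "inverse C \<le> m" by simp
  have "eventually (\<lambda>x. inverse C * g x \<le> f x \<and> f x \<le> C * g x) F"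
    using bounds
  proof eventually_elim
    case (elim x)
    then have "inverse C * g x \<le> m * g x" "M * g x \<le> C * g x"
      using C \<open>inverse C \<le> m\<close> by (simp_all add: mult_right_mono)
    with elim show ?case by linarith
  qed
  with C show ?thesis unfolding comparable_def by blast
qed

lemma one_plus_norm_powr_bounds:
  assumes "0 \<le> a"
  shows "norm x powr a \<le> (1 + norm x) powr a"
    and "1 \<le> norm x \<Longrightarrow> (1 + norm x) powr a \<le> 2 powr a * norm x powr a"
    and "1 \<le> (1 + norm x) powr a"
    and "norm x \<le> 1 \<Longrightarrow> (1 + norm x) powr a \<le> 2 powr a"
proof -
  show "norm x powr a \<le> (1 + norm x) powr a" using assms by (intro powr_mono2) auto
  show "1 \<le> (1 + norm x) powr a" using assms by (intro ge_one_powr_ge_zero) auto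
  show "(1 + norm x) powr a \<le> 2 powr a" if "norm x \<le> 1" using assms that by (intro powr_mono2) auto
  have "(1 + norm x) powr a \<le> (2 * norm x) powr a" if "1 \<le> norm x"
    using assms that by (intro powr_mono2) auto
  then show "(1 + norm x) powr a \<le> 2 powr a * norm x powr a" if "1 \<le> norm x"
    using that by (simp add: powr_mult)
qed

text \<open>Inside the unit ball the factor \<open>norm x powr b\<close> controls the singularity,
  outside it the total power \<open>a + b\<close> gives the decay. The case \<open>b = 0\<close>
  serves \<open>u\<close>, the case \<open>b = \<beta>\<close> serves \<open>v\<close>.\<close>

lemma in_Lp_inverse:
  fixes U :: "'a::euclidean_space \<Rightarrow> real"
  assumes [measurable]: "U \<in> borel_measurable lebesgue" and m: "0 < m" and ab: "0 \<le> a" "0 \<le> b"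
    and lower: "\<And>x. x \<noteq> 0 \<Longrightarrow> m * (norm x powr b * (1 + norm x) powr a) \<le> U x"
    and t: "0 < t" "b * t < real DIM('a)" "real DIM('a) < (a + b) * t"
  shows "in_Lp t (\<lambda>x. inverse (U x))"
  unfolding in_Lp_def
proof
  show "(\<lambda>x. inverse (U x)) \<in> borel_measurable lebesgue" by measurable
  let ?G = "\<lambda>x::'a. m powr - t * (indicator (ball 0 1) x * norm x powr (- (b * t)) +
      2 powr (b * t) * (1 + norm x) powr - ((a + b) * t))"
  have "integrable lebesgue ?G"
    using t ab by (intro integrable_mult_right Bochner_Integration.integrable_add
        integrable_norm_powr_ball integrable_one_plus_norm_powr) auto
  then show "integrable lebesgue (\<lambda>x. \<bar>inverse (U x)\<bar> powr t)"
  proof (rule Bochner_Integration.integrable_bound)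
    show "AE x in lebesgue. norm (\<bar>inverse (U x)\<bar> powr t) \<le> norm (?G x)"
      using AE_lebesgue_neq[of 0]
    proof eventually_elim
      case (elim x)
      let ?W = "norm x powr b * (1 + norm x) powr a"
      have pos: "0 < 1 + norm x" by (simp add: add_pos_nonneg)
      have W: "0 < ?W" using elim pos by (intro mult_pos_pos) auto
      then have "0 < m * ?W" using m by simp
      moreover from this have U: "0 < U x" using lower[OF elim] by linarith
      ultimately have "U x powr - t \<le> (m * ?W) powr - t"
        using lower[OF elim] t by (intro powr_mono2') auto
      also have "\<dots> = m powr - t * ?W powr - t" using powr_mult[of m ?W "- t"] m by simp
      also have "?W powr - t \<le> indicator (ball 0 1) x * norm x powr (- (b * t)) +
          2 powr (b * t) * (1 + norm x) powr - ((a + b) * t)"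
      proof (cases "norm x < 1")
        case True
        have "norm x powr b * 1 \<le> ?W"
          using ab by (intro mult_left_mono one_plus_norm_powr_bounds) auto
        then have "?W powr - t \<le> (norm x powr b * 1) powr - t"
          using elim t by (intro powr_mono2') auto
        then show ?thesis using True by (auto simp: powr_powr intro: add_increasing2)
      next
        case False
        \<comment> \<open>Outside the unit ball \<open>norm x\<close> is at least half of
          \<open>1 + norm x\<close>, hence the constant \<open>2 powr (b * t)\<close>.\<close>
        have "((1 + norm x) / 2) powr b \<le> norm x powr b"
          using False ab by (intro powr_mono2) auto
        then have "((1 + norm x) / 2) powr b * (1 + norm x) powr a \<le> ?W"
          by (intro mult_right_mono) auto
        moreover have "0 < ((1 + norm x) / 2) powr b * (1 + norm x) powr a"
          using pos by (intro mult_pos_pos) auto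
        ultimately have "?W powr - t \<le> (((1 + norm x) / 2) powr b * (1 + norm x) powr a) powr - t"
          using t by (intro powr_mono2') auto
        also have "((1 + norm x) / 2) powr b * (1 + norm x) powr a = 2 powr - b * (1 + norm x) powr (a + b)"
          by (simp add: powr_divide powr_minus powr_add field_simps)
        also have "\<dots> powr - t = 2 powr (b * t) * (1 + norm x) powr - ((a + b) * t)"
          by (simp add: powr_mult powr_powr)
        finally show ?thesis using False by simp
      qed
      finally have "U x powr - t \<le> ?G x" by (simp add: mult_left_mono)
      moreover have "\<bar>inverse (U x)\<bar> powr t = U x powr - t"
        using U by (simp add: powr_minus inverse_powr)
      moreover have "0 \<le> ?G x" by simp
      ultimately show ?case by simp
    qed
  qed measurable
qed

section \<open>Exponents above one and the balance of slopes\<close>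

text \<open>For \<open>p \<le> 1\<close> the integrand would stay above
  \<open>m powr (1 - p)\<close> outside the unit ball. The bound on \<open>U\<close> is asked only
  there because \<open>v\<close> vanishes at the origin.\<close>

lemma exponent_gt_one:
  fixes U :: "'a::euclidean_space \<Rightarrow> real"
  assumes "integrable lebesgue (\<lambda>x. U x powr (1 - p))" "0 < m" "\<And>x. 1 \<le> norm x \<Longrightarrow> m \<le> U x"
  shows "1 < p"
proof (rule ccontr)
  assume "\<not> 1 < p"
  then have "m powr (1 - p) \<le> U x powr (1 - p)" if "1 \<le> norm x" for x
    using assms that by (intro powr_mono2) auto
  from not_integrable_bounded_below[OF assms(1) _ this] assms(2) show False by simp
qed

text \<open>The case \<open>x = 0\<close>, where both sides are \<open>0\<close>, is included for
  the value of \<open>v\<close> at the origin.\<close>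

lemma mult_powr_minus_self:
  fixes x p :: real
  assumes "0 \<le> x"
  shows "x * x powr - p = x powr (1 - p)"
  using assms powr_add[of x 1 "- p"] by (cases "x = 0") simp_all

text \<open>The two orders of integration express the same energy through dilations of
  \<open>u\<close> by \<open>l\<close> and of \<open>v\<close> by \<open>1 / l\<close>. Each form
  has a tangent minorant, and finiteness at \<open>l = 1\<close> puts both exponents above
  \<open>1\<close>.\<close>

lemma pohozaev_balance:
  fixes u v :: "'a::euclidean_space \<Rightarrow> real" and a \<beta> p1 p2 :: real
  assumes a: "0 < a" and \<beta>: "0 < \<beta>"
    and [measurable]: "u \<in> borel_measurable lebesgue" "v \<in> borel_measurable lebesgue"
    and upos: "\<And>x. 0 < u x" and vpos: "\<And>x. x \<noteq> 0 \<Longrightarrow> 0 < v x" and v0: "v 0 = 0"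
  defines "f \<equiv> \<lambda>y. v y powr - p2 * norm y powr \<beta>" and "g \<equiv> \<lambda>y. u y powr - p1"
  defines "w \<equiv> \<lambda>x. \<integral>y. norm (x - y) powr a * g y \<partial>lebesgue"
  assumes u: "\<And>x. u x = (\<integral>y. norm (x - y) powr a * f y \<partial>lebesgue)"
    and v: "\<And>x. v x = norm x powr \<beta> * w x"
    and wf: "integrable lebesgue (\<lambda>y. (1 + norm y) powr a * f y)"
    and wg: "integrable lebesgue (\<lambda>y. (1 + norm y) powr a * g y)"
    and mu: "0 < mu" "\<And>x. mu * (1 + norm x) powr a \<le> u x"
    and Mu: "0 < Mu" "\<And>x. u x \<le> Mu * (1 + norm x) powr a"
    and mw: "0 < mw" "\<And>x. mw * (1 + norm x) powr a \<le> w x"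
  shows "1 < p1 \<and> 1 < p2 \<and> real DIM('a) / (p1 - 1) + real DIM('a) / (p2 - 1) = \<beta> + a"
proof -
  let ?L = "lebesgue \<Otimes>\<^sub>M lebesgue :: ('a \<times> 'a) measure"
  define J where "J l = (\<integral>(x, y). norm (l *\<^sub>R x - y) powr a * (f y * g x) \<partial>?L)" for l
  have [measurable]: "f \<in> borel_measurable lebesgue" "g \<in> borel_measurable lebesgue"
    unfolding f_def g_def by measurable
  have f: "0 \<le> f y" and g: "0 \<le> g y" for y by (simp_all add: f_def g_def)
  have vge: "0 \<le> v x" for x using vpos[of x] v0 by (cases "x = 0") auto
  have int: "integrable ?L (\<lambda>(x, y). norm (l *\<^sub>R x - y) powr a * (f y * g x))" for l
    by (rule dilated_energy_integrable[OF a _ _ wf wg]) measurable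
  have inner_y: "(\<integral>y. norm (l *\<^sub>R x - y) powr a * (f y * g x) \<partial>lebesgue) = u (l *\<^sub>R x) * g x" for l x
    unfolding u[of "l *\<^sub>R x"] by (simp flip: mult.assoc)
  have inner_x: "(\<integral>x. norm (l *\<^sub>R x - y) powr a * (f y * g x) \<partial>lebesgue) = l powr a * w ((1 / l) *\<^sub>R y) * f y"
    if "0 < l" for l y
  proof -
    \<comment> \<open>Homogeneity moves the dilation from \<open>x\<close> to \<open>y\<close>, so
      that the inner integral becomes \<open>w\<close> at \<open>y\<close> divided by
      \<open>l\<close>.\<close>
    have "norm (l *\<^sub>R x - y) = l * norm ((1 / l) *\<^sub>R y - x)" for x
    proof -
      have "l *\<^sub>R x - y = - (l *\<^sub>R ((1 / l) *\<^sub>R y - x))"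
        using that by (simp add: scaleR_diff_right)
      then show ?thesis using that by (simp only: norm_minus_cancel norm_scaleR)
    qed
    then have "(\<integral>x. norm (l *\<^sub>R x - y) powr a * (f y * g x) \<partial>lebesgue) =
        (\<integral>x. (l powr a * f y) * (norm ((1 / l) *\<^sub>R y - x) powr a * g x) \<partial>lebesgue)"
      using that by (intro Bochner_Integration.integral_cong) (simp_all add: powr_mult mult_ac)
    also have "\<dots> = l powr a * f y * w ((1 / l) *\<^sub>R y)"
      unfolding w_def by (rule integral_mult_right_zero)
    finally show ?thesis by (simp only: mult_ac)
  qed
  have J1: "J l = (\<integral>x. u (l *\<^sub>R x) * g x \<partial>lebesgue)"
    and int1: "integrable lebesgue (\<lambda>x. u (l *\<^sub>R x) * g x)" for l
    using lebesgue_pair.integral_fst[OF int] lebesgue_pair.integrable_fst[OF int]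
    unfolding inner_y J_def by simp_all
  have J2: "J l = (\<integral>y. l powr a * w ((1 / l) *\<^sub>R y) * f y \<partial>lebesgue)"
    and int2: "integrable lebesgue (\<lambda>y. l powr a * w ((1 / l) *\<^sub>R y) * f y)" if "0 < l" for l
    using lebesgue_pair.integral_snd[OF int, of l] lebesgue_pair.integrable_snd[OF int, of l]
    unfolding inner_x[OF that] J_def by simp_all
  define A where "A = (\<integral>x. u x powr (1 - p1) \<partial>lebesgue)"
  have ug: "u x * g x = u x powr (1 - p1)" for x
    using mult_powr_minus_self[of "u x"] upos[of x] by (simp add: g_def)
  have wfv: "w y * f y = v y powr (1 - p2)" for y
    using mult_powr_minus_self[OF vge, of y p2] v[of y] by (simp add: f_def mult_ac)
  have intu: "integrable lebesgue (\<lambda>x. u x powr (1 - p1))" and JA: "J 1 = A"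
    using int1[of 1] J1[of 1] by (simp_all add: ug A_def)
  have intv: "integrable lebesgue (\<lambda>x. v x powr (1 - p2))" and JA2: "A = (\<integral>y. v y powr (1 - p2) \<partial>lebesgue)"
    using int2[of 1] J2[of 1] JA by (simp_all add: wfv)
  have p1: "1 < p1"
  proof (rule exponent_gt_one[OF intu mu(1)])
    fix x :: 'a
    have "mu * 1 \<le> mu * (1 + norm x) powr a"
      using a mu by (intro mult_left_mono one_plus_norm_powr_bounds) auto
    then show "mu \<le> u x" using mu(2)[of x] by linarith
  qed
  have p2: "1 < p2"
  proof (rule exponent_gt_one[OF intv mw(1)])
    fix x :: 'a assume x: "1 \<le> norm x"
    have "1 * (mw * 1) \<le> norm x powr \<beta> * (mw * (1 + norm x) powr a)"
      using a mw \<beta> x by (intro mult_mono one_plus_norm_powr_bounds order_refl ge_one_powr_ge_zero) auto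
    also have "\<dots> \<le> norm x powr \<beta> * w x" using mw(2) by (intro mult_left_mono) auto
    finally show "mw \<le> v x" by (simp add: v)
  qed
  \<comment> \<open>\<open>A\<close> multiplies every slope and has to be cancelled at the
    end.\<close>
  have "0 < (\<integral>x. indicator (ball 0 1) x * u x powr (1 - p1) \<partial>lebesgue)"
    using upos by (intro integral_ball_pos intu) (auto simp: less_imp_neq[OF upos, symmetric])
  also have "\<dots> \<le> A"
    unfolding A_def using integrable_mult_indicator[OF _ intu, of "ball 0 1"]
    by (intro integral_mono intu) (auto simp: indicator_def)
  finally have "A \<noteq> 0" by simp
  obtain D where D: "(J has_real_derivative D) (at 1)"
  proof -
    have "integrable ?L (\<lambda>(x, y). norm x * norm (x - y) powr (a - 1) * (f y * g x))" if "a < 1"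
    proof -
      have up: "(M * (1 + norm x) powr a) powr - p1 = M powr - p1 * (1 + norm x) powr (- a * p1)" if "0 < M" for M and x :: 'a
        using that by (simp add: powr_mult powr_powr)
      \<comment> \<open>The negative power exchanges the two bounds on \<open>u\<close>:
        \<open>Mu\<close> bounds \<open>g\<close> from below and \<open>mu\<close> from
        above.\<close>
      obtain B where "0 \<le> B" "\<And>x. norm x powr (real DIM('a) + a) * g x \<le> B"
      proof (rule decay_of_weight_integrable[OF a _ _ _ wg])
        show "1 \<le> p1" "0 < Mu powr - p1" "0 \<le> mu powr - p1" using p1 Mu by auto
        show "Mu powr - p1 * (1 + norm x) powr (- a * p1) \<le> g x" for x
          unfolding up[OF Mu(1), symmetric] g_def using upos Mu p1 by (intro powr_mono2') auto
        show "g x \<le> mu powr - p1 * (1 + norm x) powr (- a * p1)" for x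
          unfolding up[OF mu(1), symmetric] g_def using mu p1
          by (intro powr_mono2') (auto simp: add_pos_nonneg less_imp_neq[symmetric])
      qed (use that in blast)
      then show ?thesis
        using a that f g wg integrable_of_weight[OF a _ wf]
        by (intro singular_energy_integrable) auto
    qed
    then show ?thesis
      using dilated_energy_differentiable[OF a _ _ wf wg] that unfolding J_def[abs_def] by auto
  qed
  have "real DIM('a) / (p1 - 1) + real DIM('a) / (p2 - 1) = \<beta> + a"
  proof (rule touching_slopes_eq[OF D JA \<open>A \<noteq> 0\<close>])
    fix l :: real assume l: "0 < l"
    show "A + (1 - l powr - real DIM('a)) * A / (p1 - 1) \<le> J l"
      using dilation_tangent_bound[OF p1 _ upos intu l] int1[of l] J1[of l]
      unfolding g_def A_def by simp
    \<comment> \<open>The factor \<open>norm x powr \<beta>\<close> of \<open>v\<close> contributes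
      \<open>l powr - \<beta>\<close>; the remaining \<open>l powr - a\<close> compensates the
      \<open>l powr a\<close> already present in \<open>J2\<close>.\<close>
    have vv: "v ((1 / l) *\<^sub>R x) * v x powr - p2 = l powr - (\<beta> + a) * (l powr a * w ((1 / l) *\<^sub>R x) * f x)" for x
      using l by (simp add: v[of "(1 / l) *\<^sub>R x"] f_def powr_divide powr_minus powr_diff powr_add field_simps)
    have "A + (1 - (1 / l) powr - real DIM('a)) * A / (p2 - 1) \<le>
        (\<integral>x. v ((1 / l) *\<^sub>R x) * v x powr - p2 \<partial>lebesgue)"
      unfolding JA2
    proof (rule dilation_tangent_bound[OF p2 _ vpos intv])
      show "integrable lebesgue (\<lambda>x. v ((1 / l) *\<^sub>R x) * v x powr - p2)"
        unfolding vv by (intro integrable_mult_right int2 l)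
    qed (use l in simp_all)
    also have "\<dots> = l powr - (\<beta> + a) * J l" unfolding vv J2[OF l] by (rule integral_mult_right_zero)
    also have "(1 / l) powr - real DIM('a) = l powr real DIM('a)"
      using l by (simp add: powr_divide powr_minus field_simps)
    finally have "l powr (\<beta> + a) * (A + (1 - l powr real DIM('a)) * A / (p2 - 1)) \<le>
        l powr (\<beta> + a) * (l powr - (\<beta> + a) * J l)"
      by (intro mult_left_mono) auto
    also have "\<dots> = J l" using l by (simp flip: mult.assoc powr_add)
    finally show "l powr (\<beta> + a) * (A + (1 - l powr real DIM('a)) * A / (p2 - 1)) \<le> J l" .
  qed (use p1 p2 in auto)
  with p1 p2 show ?thesis by blast
qed

section \<open>Growth, integrability and the exponent relation for solutions\<close>

theorem theorem1p4:
  fixes \<beta> p1 p2 n :: real and u v :: "real ^ 'n \<Rightarrow> real"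
  defines "n \<equiv> real CARD('n)"
  assumes "\<beta> > n"
    and "positive_entire_solutions \<beta> p1 p2 u v"
    and "p1 > \<beta> / (\<beta> - n) \<or> (2 * \<beta> / (2 * \<beta> - n) < p2 \<and> p2 < (n + \<beta>) / \<beta>)"
  shows "(comparable u (\<lambda>x. norm x powr (\<beta> - n)) at_infinity \<and>
          comparable v (\<lambda>x. norm x powr (2 * \<beta> - n)) at_infinity \<and>
          comparable v (\<lambda>x. norm x powr \<beta>) (at 0)) \<and>
         ((\<forall>s. s > n / (\<beta> - n) \<longrightarrow> in_Lp s (\<lambda>x. inverse (u x))) \<and>
          (\<forall>t. n / (2 * \<beta> - n) < t \<and> t < n / \<beta> \<longrightarrow> in_Lp t (\<lambda>x. inverse (v x)))) \<and>
         (u differentiable_on UNIV \<and> v differentiable_on UNIV \<longrightarrow>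
          p1 \<noteq> 1 \<and> p2 \<noteq> 1 \<and> 1 / (p1 - 1) + 1 / (p2 - 1) = 2 * \<beta> / n - 1)"
proof -
  define a where "a = \<beta> - n"
  have n: "0 < n" by (simp add: n_def)
  have dim: "real DIM(real ^ 'n) = n" by (simp add: n_def)
  have a: "0 < a" and \<beta>: "0 < \<beta>" using \<open>\<beta> > n\<close> n by (auto simp: a_def)
  define f where "f = (\<lambda>y. v y powr - p2 * norm y powr \<beta>)"
  define g where "g = (\<lambda>y. u y powr - p1)"
  define w where "w = (\<lambda>x. \<integral>y. norm (x - y) powr a * g y \<partial>lebesgue)"
  have sol: "u \<in> borel_measurable lebesgue" "v \<in> borel_measurable lebesgue"
    "\<And>x. 0 < u x" "\<And>x. x \<noteq> 0 \<Longrightarrow> 0 < v x" "v 0 = 0"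
    "\<And>x. has_bochner_integral lebesgue (\<lambda>y. norm (x - y) powr a * v y powr (- p2) * norm y powr \<beta>) (u x)"
    "\<And>x. has_bochner_integral lebesgue (\<lambda>y. norm (x - y) powr a * u y powr (- p1) * norm x powr \<beta>) (v x)"
    using assms(3) unfolding positive_entire_solutions_def Linfty_loc_def a_def n_def by auto
  note [measurable] = sol(1,2)
  have mf: "f \<in> borel_measurable lebesgue" and mg: "g \<in> borel_measurable lebesgue"
    unfolding f_def g_def by measurable
  have f: "0 \<le> f y" and fpos: "y \<noteq> 0 \<Longrightarrow> 0 < f y" and gpos: "0 < g y" for y
    using sol(3)[of y] sol(4)[of y] by (auto simp: f_def g_def)
  have intf: "integrable lebesgue (\<lambda>y. norm (x - y) powr a * f y)"
    and u: "u x = (\<integral>y. norm (x - y) powr a * f y \<partial>lebesgue)" for x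
    using sol(6)[of x] by (simp_all add: f_def has_bochner_integral_iff mult.assoc)
  \<comment> \<open>At \<open>x = 0\<close> the integrand for \<open>v\<close> is identically
    \<open>0\<close> and carries no information on \<open>g\<close>.\<close>
  have intg': "integrable lebesgue (\<lambda>y. norm (x - y) powr a * g y)" if "x \<noteq> 0" for x
    using sol(7)[of x] that by (simp add: g_def has_bochner_integral_iff)
  have wg: "integrable lebesgue (\<lambda>y. (1 + norm y) powr a * g y)"
    using gpos by (intro potential_weight_integrable a mg intg') (auto intro: less_imp_le)
  have wf: "integrable lebesgue (\<lambda>y. (1 + norm y) powr a * f y)"
    by (intro potential_weight_integrable a mf intf f)
  \<comment> \<open>The weighted bound, gained from points off the origin, now covers the origin as
    well.\<close>
  have intg: "integrable lebesgue (\<lambda>y. norm (x - y) powr a * g y)" for x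
    using gpos by (intro potential_integrable a mg wg) (auto intro: less_imp_le)
  have v: "v x = norm x powr \<beta> * w x" for x
    using sol(7)[of x] by (simp add: g_def w_def has_bochner_integral_iff mult.commute)
  obtain mu Mu where mu: "0 < mu" "0 < Mu" "\<And>x. mu * (1 + norm x) powr a \<le> u x"
      "\<And>x. u x \<le> Mu * (1 + norm x) powr a"
    using potential_comparable[OF a mf f fpos intf] unfolding u[symmetric] by blast
  obtain mw Mw where mw: "0 < mw" "0 < Mw" "\<And>x. mw * (1 + norm x) powr a \<le> w x"
      "\<And>x. w x \<le> Mw * (1 + norm x) powr a"
    using potential_comparable[OF a mg less_imp_le[OF gpos] gpos intg] unfolding w_def by blast
  have vlow: "mw * (norm x powr \<beta> * (1 + norm x) powr a) \<le> v x"
    and vup: "v x \<le> Mw * (norm x powr \<beta> * (1 + norm x) powr a)" for x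
    using mult_left_mono[OF mw(3)[of x], of "norm x powr \<beta>"] mult_left_mono[OF mw(4)[of x], of "norm x powr \<beta>"]
    by (simp_all add: v mult_ac)
  have large: "eventually (\<lambda>x :: real ^ 'n. 1 \<le> norm x) at_infinity"
    unfolding eventually_at_infinity by blast
  have small: "eventually (\<lambda>x :: real ^ 'n. norm x \<le> 1) (at 0)"
    unfolding eventually_at by (intro exI[of _ 1]) auto
  note P = one_plus_norm_powr_bounds[OF less_imp_le[OF a]]
  have "comparable u (\<lambda>x. norm x powr a) at_infinity"
  proof (rule comparableI[OF mu(1)], use large in eventually_elim)
    case (elim x)
    have "mu * norm x powr a \<le> mu * (1 + norm x) powr a" "Mu * (1 + norm x) powr a \<le> Mu * (2 powr a * norm x powr a)"
      using mu P[of x] elim by auto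
    then show "0 \<le> norm x powr a \<and> mu * norm x powr a \<le> u x \<and> u x \<le> (Mu * 2 powr a) * norm x powr a"
      using mu(3,4)[of x] by (simp add: mult.assoc)
  qed
  moreover have "comparable v (\<lambda>x. norm x powr (\<beta> + a)) at_infinity"
  proof (rule comparableI[OF mw(1)], use large in eventually_elim)
    case (elim x)
    have "mw * (norm x powr \<beta> * norm x powr a) \<le> mw * (norm x powr \<beta> * (1 + norm x) powr a)"
      "Mw * (norm x powr \<beta> * (1 + norm x) powr a) \<le> Mw * (norm x powr \<beta> * (2 powr a * norm x powr a))"
      using mw P[of x] elim by (auto intro!: mult_left_mono)
    then show "0 \<le> norm x powr (\<beta> + a) \<and> mw * norm x powr (\<beta> + a) \<le> v x \<and>
        v x \<le> (Mw * 2 powr a) * norm x powr (\<beta> + a)"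
      using vlow[of x] vup[of x] by (simp add: powr_add mult_ac)
  qed
  moreover have "comparable v (\<lambda>x. norm x powr \<beta>) (at 0)"
  proof (rule comparableI[OF mw(1)], use small in eventually_elim)
    case (elim x)
    have "mw * (norm x powr \<beta> * 1) \<le> mw * (norm x powr \<beta> * (1 + norm x) powr a)"
      "Mw * (norm x powr \<beta> * (1 + norm x) powr a) \<le> Mw * (norm x powr \<beta> * 2 powr a)"
      using mw P[of x] elim by (intro mult_left_mono; simp)+
    then show "0 \<le> norm x powr \<beta> \<and> mw * norm x powr \<beta> \<le> v x \<and> v x \<le> (Mw * 2 powr a) * norm x powr \<beta>"
      using vlow[of x] vup[of x] by (simp add: mult_ac)
  qed
  \<comment> \<open>With \<open>b = 0\<close> there is no singularity at the origin, and the decay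
    condition \<open>n < a * s\<close> is exactly \<open>s > n / a\<close>.\<close>
  moreover have "in_Lp s (\<lambda>x. inverse (u x))" if "s > n / a" for s
  proof (rule in_Lp_inverse[OF sol(1) mu(1), of a 0])
    have "0 < n / a" using n a by simp
    with that show "0 < s" by linarith
    show "real DIM(real ^ 'n) < (a + 0) * s" using that a unfolding dim by (simp add: field_simps)
  qed (use a n mu dim in auto)
  moreover have "in_Lp t (\<lambda>x. inverse (v x))" if "n / (\<beta> + a) < t" "t < n / \<beta>" for t
  proof (rule in_Lp_inverse[OF sol(2) mw(1), of a \<beta>])
    have "0 < n / (\<beta> + a)" using n a \<beta> by simp
    with that show "0 < t" by linarith
    show "real DIM(real ^ 'n) < (a + \<beta>) * t" using that a \<beta> unfolding dim by (simp add: field_simps)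
    show "\<beta> * t < real DIM(real ^ 'n)" using that \<beta> unfolding dim by (simp add: field_simps)
  qed (use a \<beta> vlow in auto)
  moreover have "1 < p1 \<and> 1 < p2 \<and> n / (p1 - 1) + n / (p2 - 1) = \<beta> + a"
    using pohozaev_balance[of a \<beta> u v p2 p1 mu Mu mw] a \<beta> sol u v wf wg mu mw
    unfolding dim f_def g_def w_def by blast
  then have "p1 \<noteq> 1 \<and> p2 \<noteq> 1 \<and> 1 / (p1 - 1) + 1 / (p2 - 1) = (\<beta> + a) / n"
    using n by (auto simp: field_simps)
  moreover have "\<beta> + a = 2 * \<beta> - n" by (simp add: a_def)
  moreover have "(2 * \<beta> - n) / n = 2 * \<beta> / n - 1" using n by (simp add: field_simps)
  ultimately show ?thesis unfolding a_def[symmetric] by simp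
qed

end
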